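(* Let $D$ be a finite-dimensional graded-division algebra over a field $\mathbb F$, with (abelian) support $T$ and grading $\Gamma_D$, and let $\varphi_0$ be a degree-preserving involution on $D$. Let $q$ and $s$ be nonnegative integers (not both zero), let $\delta\in\{\pm1\}$, and let $\underline d=(d_1,\dots,d_q)$ be a $q$-tuple of elements $d_i\in D^\times_{\mathrm{gr}}$ satisfying $\varphi_0(d_i)=\delta d_i$. Assume that $(q,s)\ne(2,0)$ and that the grading $\Gamma_D$ on $D$ is fine. Then the grading $\Gamma_{\mathcal M}(D,\varphi_0,q,s,\underline d,\delta)$ is fine (as a grading on an algebra with involution).
   Context: All algebras are associative over an arbitrary field $\mathbb F$; all grading groups are abelian. An involution is an $\mathbb F$-linear antiautomorphism of order at most 2; degree-preserving means each homogeneous component is mapped to itself. A grading on an algebra with involution is a grading on the algebra for which the involution is degree-preserving. A graded-division algebra is a unital graded algebra in which all nonzero homogeneous elements are invertible; $D^\times_{\mathrm{gr}}$ is the group of its nonzero homogeneous elements. A grading $A=\bigoplus_{g\in G}A_g$ is a refinement of $A=\bigoplus_{h\in H}A'_h$ if every $A_g$ is contained in some $A'_h$; it is proper if this inclusion is proper for some $g$ with $A_g\ne0$. A grading is fine if it has no proper refinement (by gradings, by abelian groups, on the same algebra, respectively algebra with involution). Construction. With $D,T,\varphi_0,q,s,\delta,\underline d$ as in the claim, let $t_i=\deg d_i$, $k=q+2s$. $\widetilde G(T,q,s,\underline t)$ is the quotient of $F\times T$, with $F$ free abelian on $\tilde g_1,\dots,\tilde g_k$, by the relations $\tilde g_1^2t_1^{-1}=\dots=\tilde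 g_q^2t_q^{-1}=\tilde g_{q+1}\tilde g_{q+2}=\dots=\tilde g_{q+2s-1}\tilde g_{q+2s}$; $T$ embeds in it. $\mathcal M(D,\varphi_0,q,s,\underline d,\delta)$ is $M_k(D)=M_k(\mathbb F)\otimes D$ with $\widetilde G(T,q,s,\underline t)$-grading $\deg(E_{ij}\otimes d)=\tilde g_i\tilde g_j^{-1}t$ for $0\ne d\in D_t$ (denoted $\Gamma_{\mathcal M}(D,\varphi_0,q,s,\underline d,\delta)$) and involution $X\mapsto\Phi^{-1}\varphi_0(X^T)\Phi$ ($\varphi_0$ applied entrywise), where $\Phi=\mathrm{diag}\left(d_1,\dots,d_q,\begin{bmatrix}0&1\\ \delta&0\end{bmatrix},\dots,\begin{bmatrix}0&1\\ \delta&0\end{bmatrix}\right)$ with $s$ blocks of size 2. *)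

theory Defs
  imports
    "HOL-Algebra.Free_Abelian_Groups"
    "Jordan_Normal_Form.Matrix"
begin

text \<open>Algebras are represented by the \<^type>\<open>module\<close> records of HOL-Algebra: carrier, ring operations
  and scalar multiplication. Scalars form a type of class \<^class>\<open>field\<close>, seen as the ring
  \<^term>\<open>scalar_ring\<close>. The locale \<^locale>\<open>algebra\<close> of HOL-Algebra is not usable, as it demands
  commutativity.\<close>

abbreviation scalar_ring :: "'f::field ring" where
  "scalar_ring \<equiv> \<lparr>carrier = UNIV, monoid.mult = (*), one = 1, zero = 0, add = (+)\<rparr>"

locale assoc_algebra = vector_space scale
  for scale :: "'f::field \<Rightarrow> 'd::ring_1 \<Rightarrow> 'd" +
  assumes scale_mult_left: "scale c x * y = scale c (x * y)"
    and scale_mult_right: "x * scale c y = scale c (x * y)"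

definition type_algebra :: "('f \<Rightarrow> 'd \<Rightarrow> 'd) \<Rightarrow> ('f::field, 'd::ring_1) module" where
  "type_algebra scale =
     \<lparr>carrier = UNIV, monoid.mult = (*), one = 1, zero = 0, add = (+), smult = scale\<rparr>"

definition mat_algebra :: "('f \<Rightarrow> 'd \<Rightarrow> 'd) \<Rightarrow> nat \<Rightarrow> ('f::field, 'd::ring_1 mat) module" where
  "mat_algebra scale k =
     \<lparr>carrier = carrier_mat k k, monoid.mult = (*), one = 1\<^sub>m k, zero = 0\<^sub>m k k, add = (+),
      smult = (\<lambda>c. map_mat (scale c))\<rparr>"


section \<open>Gradings and involutions\<close>

text \<open>The last conjunct says that the algebra is the direct sum of the components; \<open>c\<close> is the family
  of homogeneous components of \<open>a\<close>.\<close>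

definition group_grading ::
    "'g monoid \<Rightarrow> ('f::field, 'a) module \<Rightarrow> ('g \<Rightarrow> 'a set) \<Rightarrow> bool" where
  "group_grading G A \<Gamma> \<longleftrightarrow>
     comm_group G \<and>
     (\<forall>g\<in>carrier G. submodule (\<Gamma> g) scalar_ring A) \<and>
     (\<forall>g\<in>carrier G. \<forall>h\<in>carrier G. \<forall>x\<in>\<Gamma> g. \<forall>y\<in>\<Gamma> h. x \<otimes>\<^bsub>A\<^esub> y \<in> \<Gamma> (g \<otimes>\<^bsub>G\<^esub> h)) \<and>
     (\<forall>a\<in>carrier A. \<exists>!c. c \<in> (\<Pi>\<^sub>E g\<in>carrier G. \<Gamma> g) \<and>
        finite {g \<in> carrier G. c g \<noteq> \<zero>\<^bsub>A\<^esub>} \<and>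
        a = (\<Oplus>\<^bsub>A\<^esub>g\<in>{g \<in> carrier G. c g \<noteq> \<zero>\<^bsub>A\<^esub>}. c g))"

definition grading_support ::
    "'g monoid \<Rightarrow> ('f::field, 'a) module \<Rightarrow> ('g \<Rightarrow> 'a set) \<Rightarrow> 'g set" where
  "grading_support G A \<Gamma> = {g \<in> carrier G. \<Gamma> g \<noteq> {\<zero>\<^bsub>A\<^esub>}}"

definition nonzero_homogeneous ::
    "'g monoid \<Rightarrow> ('f::field, 'a) module \<Rightarrow> ('g \<Rightarrow> 'a set) \<Rightarrow> 'a set" where
  "nonzero_homogeneous G A \<Gamma> = (\<Union>g\<in>carrier G. \<Gamma> g) - {\<zero>\<^bsub>A\<^esub>}"

text \<open>Meaningful only for nonzero homogeneous \<open>x\<close>.\<close>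

definition degree_of :: "'g monoid \<Rightarrow> ('g \<Rightarrow> 'a set) \<Rightarrow> 'a \<Rightarrow> 'g" where
  "degree_of G \<Gamma> x = (THE g. g \<in> carrier G \<and> x \<in> \<Gamma> g)"

definition graded_division ::
    "'g monoid \<Rightarrow> ('f::field, 'a) module \<Rightarrow> ('g \<Rightarrow> 'a set) \<Rightarrow> bool" where
  "graded_division G A \<Gamma> \<longleftrightarrow>
     group_grading G A \<Gamma> \<and> nonzero_homogeneous G A \<Gamma> \<subseteq> Units A"

definition algebra_involution :: "('f::field, 'a) module \<Rightarrow> ('a \<Rightarrow> 'a) \<Rightarrow> bool" where
  "algebra_involution A \<phi> \<longleftrightarrow>
     \<phi> \<in> carrier A \<rightarrow> carrier A \<and>
     (\<forall>x\<in>carrier A. \<forall>y\<in>carrier A. \<phi> (x \<oplus>\<^bsub>A\<^esub> y) = \<phi> x \<oplus>\<^bsub>A\<^esub> \<phi> y) \<and>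
     (\<forall>c. \<forall>x\<in>carrier A. \<phi> (c \<odot>\<^bsub>A\<^esub> x) = c \<odot>\<^bsub>A\<^esub> \<phi> x) \<and>
     (\<forall>x\<in>carrier A. \<forall>y\<in>carrier A. \<phi> (x \<otimes>\<^bsub>A\<^esub> y) = \<phi> y \<otimes>\<^bsub>A\<^esub> \<phi> x) \<and>
     (\<forall>x\<in>carrier A. \<phi> (\<phi> x) = x)"

definition involution_grading ::
    "'g monoid \<Rightarrow> ('f::field, 'a) module \<Rightarrow> ('a \<Rightarrow> 'a) \<Rightarrow> ('g \<Rightarrow> 'a set) \<Rightarrow> bool" where
  "involution_grading G A \<phi> \<Gamma> \<longleftrightarrow>
     group_grading G A \<Gamma> \<and> algebra_involution A \<phi> \<and> (\<forall>g\<in>carrier G. \<phi> ` \<Gamma> g \<subseteq> \<Gamma> g)"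


section \<open>Refinements and fine gradings\<close>

text \<open>In \<open>proper_refinement H \<Delta> G \<Gamma> A\<close> it is \<open>\<Delta>\<close> that refines \<open>\<Gamma>\<close>. A nonzero \<open>\<Delta> h\<close> is contained in
  exactly one \<open>\<Gamma> g\<close>, so the second conjunct speaks about that \<open>g\<close>.\<close>

definition refinement ::
    "'h monoid \<Rightarrow> ('h \<Rightarrow> 'a set) \<Rightarrow> 'g monoid \<Rightarrow> ('g \<Rightarrow> 'a set) \<Rightarrow> bool" where
  "refinement H \<Delta> G \<Gamma> \<longleftrightarrow> (\<forall>h\<in>carrier H. \<exists>g\<in>carrier G. \<Delta> h \<subseteq> \<Gamma> g)"

definition proper_refinement ::
    "'h monoid \<Rightarrow> ('h \<Rightarrow> 'a set) \<Rightarrow> 'g monoid \<Rightarrow> ('g \<Rightarrow> 'a set) \<Rightarrow> ('f::field, 'a) module \<Rightarrow> bool" where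
  "proper_refinement H \<Delta> G \<Gamma> A \<longleftrightarrow>
     refinement H \<Delta> G \<Gamma> \<and>
     (\<exists>h\<in>carrier H. \<Delta> h \<noteq> {\<zero>\<^bsub>A\<^esub>} \<and> (\<exists>g\<in>carrier G. \<Delta> h \<subset> \<Gamma> g))"

text \<open>HOL cannot quantify over all types inside a formula, so the groups of the competing gradings are
  taken in the type \<open>'h\<close> given as first argument. For a finite-dimensional algebra \<open>'h = nat\<close>
  already covers all abelian groups: only the finite support of a grading matters, the subgroup
  it generates is countable, hence isomorphic to a group carried by a set of natural numbers, and
  restricting a grading to that subgroup does not change the nonzero components.\<close>

definition fine_grading ::
    "'h itself \<Rightarrow> 'g monoid \<Rightarrow> ('f::field, 'a) module \<Rightarrow> ('g \<Rightarrow> 'a set) \<Rightarrow> bool" where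
  "fine_grading _ G A \<Gamma> \<longleftrightarrow>
     group_grading G A \<Gamma> \<and>
     \<not> (\<exists>(H :: 'h monoid) \<Delta>. group_grading H A \<Delta> \<and> proper_refinement H \<Delta> G \<Gamma> A)"

definition fine_involution_grading ::
    "'h itself \<Rightarrow> 'g monoid \<Rightarrow> ('f::field, 'a) module \<Rightarrow> ('a \<Rightarrow> 'a) \<Rightarrow> ('g \<Rightarrow> 'a set) \<Rightarrow> bool" where
  "fine_involution_grading _ G A \<phi> \<Gamma> \<longleftrightarrow>
     involution_grading G A \<phi> \<Gamma> \<and>
     \<not> (\<exists>(H :: 'h monoid) \<Delta>. involution_grading H A \<phi> \<Delta> \<and> proper_refinement H \<Delta> G \<Gamma> A)"


section \<open>The graded algebra with involution \<open>\<M>(D, \<phi>\<^sub>0, q, s, d, \<delta>)\<close>\<close>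

text \<open>Indices start at 0 throughout, the tuples \<open>(t\<^sub>i)\<close> and \<open>(d\<^sub>i)\<close> are lists of length \<open>q\<close>, and the
  free abelian group is written additively.\<close>

definition gt_free :: "'t monoid \<Rightarrow> nat \<Rightarrow> nat \<Rightarrow> ((nat \<Rightarrow>\<^sub>0 int) \<times> 't) monoid" where
  "gt_free T q s = free_Abelian_group {..<q + 2 * s} \<times>\<times> T"

definition gt_equated :: "'t monoid \<Rightarrow> nat \<Rightarrow> nat \<Rightarrow> 't list \<Rightarrow> ((nat \<Rightarrow>\<^sub>0 int) \<times> 't) set" where
  "gt_equated T q s ts =
     {(frag_of i + frag_of i, inv\<^bsub>T\<^esub> (ts ! i)) | i. i < q} \<union>
     {(frag_of (q + 2 * j) + frag_of (q + 2 * j + 1), \<one>\<^bsub>T\<^esub>) | j. j < s}"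

definition gt_relations :: "'t monoid \<Rightarrow> nat \<Rightarrow> nat \<Rightarrow> 't list \<Rightarrow> ((nat \<Rightarrow>\<^sub>0 int) \<times> 't) set" where
  "gt_relations T q s ts = generate (gt_free T q s)
     {x \<otimes>\<^bsub>gt_free T q s\<^esub> inv\<^bsub>gt_free T q s\<^esub> y |x y.
        x \<in> gt_equated T q s ts \<and> y \<in> gt_equated T q s ts}"

definition G_tilde :: "'t monoid \<Rightarrow> nat \<Rightarrow> nat \<Rightarrow> 't list \<Rightarrow> ((nat \<Rightarrow>\<^sub>0 int) \<times> 't) set monoid" where
  "G_tilde T q s ts = gt_free T q s Mod gt_relations T q s ts"

text \<open>The class of \<open>g\<^sub>i g\<^sub>j\<^sup>-\<^sup>1 t\<close>.\<close>

definition unit_degree ::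
    "'t monoid \<Rightarrow> nat \<Rightarrow> nat \<Rightarrow> 't list \<Rightarrow> nat \<Rightarrow> nat \<Rightarrow> 't \<Rightarrow> ((nat \<Rightarrow>\<^sub>0 int) \<times> 't) set" where
  "unit_degree T q s ts i j t =
     gt_relations T q s ts #>\<^bsub>gt_free T q s\<^esub> (frag_of i - frag_of j, t)"

text \<open>\<open>E\<^sub>i\<^sub>j \<otimes> d\<close>, where \<open>M\<^sub>k(\<bbbF>) \<otimes> D\<close> is identified with \<open>M\<^sub>k(D)\<close>.\<close>

definition unit_mat :: "nat \<Rightarrow> nat \<Rightarrow> nat \<Rightarrow> 'd::zero \<Rightarrow> 'd mat" where
  "unit_mat k i j d = mat k k (\<lambda>(a, b). if a = i \<and> b = j then d else 0)"

text \<open>The component of degree \<open>g\<close> is the linear span of the \<open>E\<^sub>i\<^sub>j \<otimes> d\<close> of degree \<open>g\<close>.\<close>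

definition M_grading ::
    "('f::field \<Rightarrow> 'd::ring_1 \<Rightarrow> 'd) \<Rightarrow> 't monoid \<Rightarrow> ('t \<Rightarrow> 'd set) \<Rightarrow> nat \<Rightarrow> nat \<Rightarrow> 't list
      \<Rightarrow> ((nat \<Rightarrow>\<^sub>0 int) \<times> 't) set \<Rightarrow> 'd mat set" where
  "M_grading scale T \<Gamma> q s ts g =
     (\<lambda>S. submodule S scalar_ring (mat_algebra scale (q + 2 * s))) hull
       {unit_mat (q + 2 * s) i j d | i j t d.
          i < q + 2 * s \<and> j < q + 2 * s \<and> t \<in> carrier T \<and> d \<in> \<Gamma> t \<and> unit_degree T q s ts i j t = g}"

definition Phi_mat :: "('f::field \<Rightarrow> 'd::ring_1 \<Rightarrow> 'd) \<Rightarrow> nat \<Rightarrow> 'd list \<Rightarrow> 'f \<Rightarrow> 'd mat" where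
  "Phi_mat scale s ds \<delta> = diag_block_mat
     (map (\<lambda>d. mat_of_rows_list 1 [[d]]) ds @
      replicate s (mat_of_rows_list 2 [[0, 1], [scale \<delta> 1, 0]]))"

definition M_involution ::
    "('f::field \<Rightarrow> 'd::ring_1 \<Rightarrow> 'd) \<Rightarrow> ('d \<Rightarrow> 'd) \<Rightarrow> nat \<Rightarrow> nat \<Rightarrow> 'd list \<Rightarrow> 'f \<Rightarrow> 'd mat \<Rightarrow> 'd mat" where
  "M_involution scale \<phi>\<^sub>0 q s ds \<delta> X =
     inv\<^bsub>mat_algebra scale (q + 2 * s)\<^esub> (Phi_mat scale s ds \<delta>)
       * map_mat \<phi>\<^sub>0 (transpose_mat X) * Phi_mat scale s ds \<delta>"

end

theory Submission
  imports Defs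
begin

text \<open>Let \<open>\<Delta>\<close> be a \<open>\<phi>\<close>-invariant refinement of \<open>\<Gamma>\<^sub>\<M>\<close>, and let \<open>\<sigma>\<close> be the involution on indices that fixes the first \<open>q\<close>
  of them and swaps the two members of each pair. In the universal group \<open>G\<close> the degree of \<open>E\<^sub>i\<^sub>j \<otimes> d\<close> with \<open>i \<noteq> j\<close> is shared only
  by elements of \<open>E\<^sub>i\<^sub>j \<otimes> D\<close> and of \<open>E\<^bsub>\<sigma>(j)\<sigma>(i)\<^esub> \<otimes> D\<close>. A product of \<open>\<Delta>\<close>-homogeneous elements of the degrees of
  \<open>E\<^sub>i\<^sub>l\<close> and \<open>E\<^sub>l\<^sub>i\<close> is therefore diagonal and supported on \<open>{i, \<sigma>(l)}\<close>; multiplying two such products for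
  different \<open>l\<close> gives a \<open>\<Delta>\<close>-homogeneous \<open>E\<^sub>i\<^sub>i \<otimes> d\<^sub>i\<close> with \<open>d\<^sub>i \<noteq> 0\<close>. Comparing components in
  \<open>E\<^sub>i\<^sub>i (E\<^sub>j\<^sub>j \<otimes> d\<^sub>j)\<close> shows that each \<open>E\<^sub>i\<^sub>i\<close> has trivial \<open>\<Delta>\<close>-degree, so \<open>\<Delta>\<close> restricts to gradings of the corners
  \<open>E\<^sub>i\<^sub>i \<otimes> D\<close> refining \<open>\<Gamma>\<^sub>D\<close>. As \<open>\<Gamma>\<^sub>D\<close> is fine, \<open>E\<^sub>i\<^sub>i \<otimes> D\<^sub>e\<close> has trivial \<open>\<Delta>\<close>-degree, and hence every \<open>E\<^sub>i\<^sub>j \<otimes> D\<^sub>t\<close> is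
  \<open>\<Delta>\<close>-homogeneous. The coincidences of degrees in \<open>G\<close> persist for \<open>\<Delta>\<close>: those on the diagonal since the group
  is abelian, the others since \<open>\<Delta>\<close> is \<open>\<phi>\<close>-invariant.\<close>

section \<open>Homogeneous components\<close>

text \<open>\<open>group_grading\<close> contains neither the ring nor the module axioms, so they
  are assumed separately. The locale serves for \<open>D\<close>, for both gradings of the matrix
  algebra and for the gradings of the corners.\<close>

locale graded_algebra = G: comm_group G + A: ring A + L: module scalar_ring A
  for G :: "'g monoid" and A :: "('f::field, 'a) module" +
  fixes \<Gamma> :: "'g \<Rightarrow> 'a set"
  assumes grading: "group_grading G A \<Gamma>"
begin

text \<open>The homogeneous component of \<open>a\<close> in degree \<open>g\<close>. The
  \<open>THE\<close> is legitimate because \<open>group_grading\<close> asserts a unique family,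
  taken extensional so that it is unique as a function.\<close>

definition hpart :: "'g \<Rightarrow> 'a \<Rightarrow> 'a" where
  "hpart g a = (THE c. c \<in> (\<Pi>\<^sub>E g\<in>carrier G. \<Gamma> g) \<and>
        finite {g \<in> carrier G. c g \<noteq> \<zero>\<^bsub>A\<^esub>} \<and>
        a = (\<Oplus>\<^bsub>A\<^esub>g\<in>{g \<in> carrier G. c g \<noteq> \<zero>\<^bsub>A\<^esub>}. c g)) g"

definition hsupp :: "'a \<Rightarrow> 'g set" where
  "hsupp a = {g \<in> carrier G. hpart g a \<noteq> \<zero>\<^bsub>A\<^esub>}"

lemma component_submodule: "g \<in> carrier G \<Longrightarrow> submodule (\<Gamma> g) scalar_ring A"
  using grading unfolding group_grading_def by blast

lemma component_closed: "g \<in> carrier G \<Longrightarrow> x \<in> \<Gamma> g \<Longrightarrow> x \<in> carrier A"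
  using L.submoduleE(1)[OF component_submodule] by blast

lemma component_add: "g \<in> carrier G \<Longrightarrow> x \<in> \<Gamma> g \<Longrightarrow> y \<in> \<Gamma> g \<Longrightarrow> x \<oplus>\<^bsub>A\<^esub> y \<in> \<Gamma> g"
  using L.submoduleE(5)[OF component_submodule] .

lemma component_smult: "g \<in> carrier G \<Longrightarrow> x \<in> \<Gamma> g \<Longrightarrow> c \<odot>\<^bsub>A\<^esub> x \<in> \<Gamma> g"
  using L.submoduleE(4)[OF component_submodule] by simp

lemma component_zero: "g \<in> carrier G \<Longrightarrow> \<zero>\<^bsub>A\<^esub> \<in> \<Gamma> g"
  using subgroup.one_closed[OF submodule.axioms(1)[OF component_submodule]] by simp

lemma component_mult:
  "g \<in> carrier G \<Longrightarrow> h \<in> carrier G \<Longrightarrow> x \<in> \<Gamma> g \<Longrightarrow> y \<in> \<Gamma> h \<Longrightarrow> x \<otimes>\<^bsub>A\<^esub> y \<in> \<Gamma> (g \<otimes>\<^bsub>G\<^esub> h)"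
  using grading unfolding group_grading_def by blast

lemma component_finsum:
  assumes "g \<in> carrier G" "\<And>i. i \<in> I \<Longrightarrow> f i \<in> \<Gamma> g"
  shows "finsum A f I \<in> \<Gamma> g"
  using assms(2)
proof (induction I rule: infinite_finite_induct)
  case (insert i I)
  have "f \<in> I \<rightarrow> carrier A" "f i \<in> carrier A"
    using insert.prems component_closed[OF assms(1)] by auto
  then show ?case
    using insert assms(1) by (simp add: component_add)
qed (simp_all add: A.finsum_infinite component_zero[OF assms(1)])

lemma hpart_spec:
  assumes "a \<in> carrier A"
  shows hpart_in: "g \<in> carrier G \<Longrightarrow> hpart g a \<in> \<Gamma> g"
    and finite_hsupp: "finite (hsupp a)"
    and hpart_sum: "a = (\<Oplus>\<^bsub>A\<^esub>g\<in>hsupp a. hpart g a)"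
proof -
  let ?P = "\<lambda>c. c \<in> (\<Pi>\<^sub>E g\<in>carrier G. \<Gamma> g) \<and>
        finite {g \<in> carrier G. c g \<noteq> \<zero>\<^bsub>A\<^esub>} \<and>
        a = (\<Oplus>\<^bsub>A\<^esub>g\<in>{g \<in> carrier G. c g \<noteq> \<zero>\<^bsub>A\<^esub>}. c g)"
  have "\<exists>!c. ?P c"
    using grading assms unfolding group_grading_def by blast
  then have *: "?P (\<lambda>g. hpart g a)"
    unfolding hpart_def by (rule theI')
  show "g \<in> carrier G \<Longrightarrow> hpart g a \<in> \<Gamma> g"
    using * by auto
  show "finite (hsupp a)" "a = (\<Oplus>\<^bsub>A\<^esub>g\<in>hsupp a. hpart g a)"
    unfolding hsupp_def using * by auto
qed

lemma hpart_closed: "a \<in> carrier A \<Longrightarrow> g \<in> carrier G \<Longrightarrow> hpart g a \<in> carrier A"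
  using hpart_in component_closed by blast

text \<open>Uniqueness of the decomposition in usable form: once an element is written as a finite
  sum with terms in distinct components, its homogeneous components can be read off.\<close>

lemma hpart_unique:
  assumes S: "finite S" "S \<subseteq> carrier G" and f: "\<And>g. g \<in> S \<Longrightarrow> f g \<in> \<Gamma> g"
    and a: "a = finsum A f S" and g: "g \<in> carrier G"
  shows "hpart g a = (if g \<in> S then f g else \<zero>\<^bsub>A\<^esub>)"
proof -
  let ?P = "\<lambda>c. c \<in> (\<Pi>\<^sub>E g\<in>carrier G. \<Gamma> g) \<and>
        finite {g \<in> carrier G. c g \<noteq> \<zero>\<^bsub>A\<^esub>} \<and>
        a = (\<Oplus>\<^bsub>A\<^esub>g\<in>{g \<in> carrier G. c g \<noteq> \<zero>\<^bsub>A\<^esub>}. c g)"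
  \<comment> \<open>Extension of \<open>f\<close> by zero to all degrees, made extensional: this is
    the shape of family to which the uniqueness in \<open>group_grading\<close> applies.\<close>
  define c where "c = (\<lambda>g\<in>carrier G. if g \<in> S then f g else \<zero>\<^bsub>A\<^esub>)"
  have fc: "f \<in> S \<rightarrow> carrier A"
    using f S(2) component_closed by blast
  have sub: "{g \<in> carrier G. c g \<noteq> \<zero>\<^bsub>A\<^esub>} \<subseteq> S"
    by (auto simp: c_def split: if_splits)
  have "finsum A c {g \<in> carrier G. c g \<noteq> \<zero>\<^bsub>A\<^esub>} = finsum A f S"
    by (rule A.add.finprod_mono_neutral_cong_left[OF S(1) sub])
      (use S fc in \<open>auto simp: c_def split: if_splits\<close>)
  moreover have "c \<in> (\<Pi>\<^sub>E g\<in>carrier G. \<Gamma> g)"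
    using f by (auto simp: c_def component_zero)
  ultimately have Pc: "?P c"
    using finite_subset[OF sub S(1)] a by simp
  have "a \<in> carrier A"
    unfolding a using fc by simp
  then have "\<exists>!c. ?P c"
    using grading unfolding group_grading_def by blast
  from theI'[OF this] this Pc have "(THE c. ?P c) = c"
    by blast
  then show ?thesis
    using g unfolding hpart_def c_def by auto
qed

lemma hpart_sum_over:
  assumes "a \<in> carrier A" "finite S" "hsupp a \<subseteq> S" "S \<subseteq> carrier G"
  shows "(\<Oplus>\<^bsub>A\<^esub>g\<in>S. hpart g a) = a"
proof -
  have "(\<Oplus>\<^bsub>A\<^esub>g\<in>hsupp a. hpart g a) = (\<Oplus>\<^bsub>A\<^esub>g\<in>S. hpart g a)"
    by (rule A.add.finprod_mono_neutral_cong_left)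
      (use assms hpart_closed in \<open>auto simp: hsupp_def\<close>)
  then show ?thesis
    using hpart_sum[OF assms(1)] by simp
qed

lemma hpart_add:
  assumes "a \<in> carrier A" "b \<in> carrier A" "g \<in> carrier G"
  shows "hpart g (a \<oplus>\<^bsub>A\<^esub> b) = hpart g a \<oplus>\<^bsub>A\<^esub> hpart g b"
proof -
  let ?S = "hsupp a \<union> hsupp b"
  have S: "finite ?S" "?S \<subseteq> carrier G"
    using finite_hsupp assms by (auto simp: hsupp_def)
  have "a \<oplus>\<^bsub>A\<^esub> b = (\<Oplus>\<^bsub>A\<^esub>g\<in>?S. hpart g a) \<oplus>\<^bsub>A\<^esub> (\<Oplus>\<^bsub>A\<^esub>g\<in>?S. hpart g b)"
    using hpart_sum_over[OF assms(1) S(1) _ S(2)] hpart_sum_over[OF assms(2) S(1) _ S(2)] by simp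
  also have "\<dots> = (\<Oplus>\<^bsub>A\<^esub>g\<in>?S. hpart g a \<oplus>\<^bsub>A\<^esub> hpart g b)"
    using S(2) assms hpart_closed by (intro A.finsum_addf[symmetric]) auto
  finally have "hpart g (a \<oplus>\<^bsub>A\<^esub> b) = (if g \<in> ?S then hpart g a \<oplus>\<^bsub>A\<^esub> hpart g b else \<zero>\<^bsub>A\<^esub>)"
    using S(2) assms by (intro hpart_unique[OF S]) (auto intro: component_add hpart_in)
  then show ?thesis
    using assms by (auto simp: hsupp_def)
qed

lemma hpart_homogeneous:
  assumes "x \<in> \<Gamma> h" "h \<in> carrier G" "g \<in> carrier G"
  shows "hpart g x = (if g = h then x else \<zero>\<^bsub>A\<^esub>)"
  using hpart_unique[of "{h}" "\<lambda>_. x" x g] assms component_closed[OF assms(2,1)] by simp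

lemma hpart_zero: "g \<in> carrier G \<Longrightarrow> hpart g \<zero>\<^bsub>A\<^esub> = \<zero>\<^bsub>A\<^esub>"
  using hpart_homogeneous[OF component_zero[OF G.one_closed], of g] by simp

text \<open>The component of \<open>x\<close> in degree \<open>g\<close> is \<open>x\<close> itself
  by the first membership, and would be zero by the second one if \<open>g\<close> and
  \<open>h\<close> differed.\<close>

lemma component_disjoint:
  "x \<in> \<Gamma> g \<Longrightarrow> x \<in> \<Gamma> h \<Longrightarrow> g \<in> carrier G \<Longrightarrow> h \<in> carrier G \<Longrightarrow> x \<noteq> \<zero>\<^bsub>A\<^esub> \<Longrightarrow> g = h"
  using hpart_homogeneous[of x g g] hpart_homogeneous[of x h g] by (auto split: if_splits)

lemma hpart_finsum:
  assumes "g \<in> carrier G" "f \<in> I \<rightarrow> carrier A"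
  shows "hpart g (finsum A f I) = (\<Oplus>\<^bsub>A\<^esub>i\<in>I. hpart g (f i))"
  using assms(2)
proof (induction I rule: infinite_finite_induct)
  case (insert i I)
  then have "(\<lambda>i. hpart g (f i)) \<in> I \<rightarrow> carrier A" "hpart g (f i) \<in> carrier A"
    using hpart_closed assms(1) by auto
  then show ?case
    using insert assms(1) by (auto simp: hpart_add)
qed (simp_all add: A.finsum_infinite hpart_zero assms(1))

lemma hpart_smult:
  assumes "a \<in> carrier A" "g \<in> carrier G"
  shows "hpart g (c \<odot>\<^bsub>A\<^esub> a) = c \<odot>\<^bsub>A\<^esub> hpart g a"
proof -
  have sum_smult: "c \<odot>\<^bsub>A\<^esub> finsum A f I = (\<Oplus>\<^bsub>A\<^esub>i\<in>I. c \<odot>\<^bsub>A\<^esub> f i)" if "f \<in> I \<rightarrow> carrier A" for f I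
    using that
  proof (induction I rule: infinite_finite_induct)
    case (insert i I)
    then have "(\<lambda>i. c \<odot>\<^bsub>A\<^esub> f i) \<in> I \<rightarrow> carrier A" "c \<odot>\<^bsub>A\<^esub> f i \<in> carrier A"
      using L.smult_closed by auto
    then show ?case
      using insert L.smult_r_distr[of c] by (auto simp: Pi_def)
  qed (use L.smult_r_null[of c] in \<open>simp_all add: A.finsum_infinite\<close>)
  have fin: "finite (hsupp a)" "hsupp a \<subseteq> carrier G"
    using finite_hsupp[OF assms(1)] by (auto simp: hsupp_def)
  have "c \<odot>\<^bsub>A\<^esub> a = (\<Oplus>\<^bsub>A\<^esub>g\<in>hsupp a. c \<odot>\<^bsub>A\<^esub> hpart g a)"
    using sum_smult[of "\<lambda>g. hpart g a" "hsupp a"] hpart_sum[OF assms(1)] fin(2) assms(1) hpart_closed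
    by auto
  then have "hpart g (c \<odot>\<^bsub>A\<^esub> a) = (if g \<in> hsupp a then c \<odot>\<^bsub>A\<^esub> hpart g a else \<zero>\<^bsub>A\<^esub>)"
    using assms fin(2) by (intro hpart_unique[OF fin]) (auto intro: component_smult hpart_in)
  then show ?thesis
    using assms(2) L.smult_r_null[of c] by (auto simp: hsupp_def)
qed

lemma finsum_delta:
  assumes "finite I" "f \<in> I \<rightarrow> carrier A" "i \<notin> I \<Longrightarrow> f i = \<zero>\<^bsub>A\<^esub>"
  shows "(\<Oplus>\<^bsub>A\<^esub>j\<in>I. if j = i then f j else \<zero>\<^bsub>A\<^esub>) = f i"
proof (cases "i \<in> I")
  case True
  then show ?thesis
    using A.add.finprod_singleton_swap[OF True assms(1,2)] by simp
next
  case False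
  then have "(\<Oplus>\<^bsub>A\<^esub>j\<in>I. if j = i then f j else \<zero>\<^bsub>A\<^esub>) = \<zero>\<^bsub>A\<^esub>"
    by (intro A.add.finprod_one_eqI) auto
  then show ?thesis
    using assms(3) False by simp
qed

text \<open>Left multiplication by \<open>y\<close> sends the component of degree \<open>g'\<close>
  into degree \<open>h g'\<close>. Translation by \<open>h\<close> is injective, so distinct
  components stay distinct and exactly one term survives.\<close>

lemma hpart_mult_left:
  assumes y: "y \<in> \<Gamma> h" and x: "x \<in> carrier A" and g: "g \<in> carrier G" and h: "h \<in> carrier G"
  shows "hpart (h \<otimes>\<^bsub>G\<^esub> g) (y \<otimes>\<^bsub>A\<^esub> x) = y \<otimes>\<^bsub>A\<^esub> hpart g x"
proof -
  have fin: "finite (hsupp x)" "hsupp x \<subseteq> carrier G" and yc: "y \<in> carrier A"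
    using finite_hsupp[OF x] component_closed[OF h y] by (auto simp: hsupp_def)
  have clo: "(\<lambda>g. hpart g x) \<in> hsupp x \<rightarrow> carrier A"
    using fin(2) x hpart_closed by auto
  have "hpart (h \<otimes>\<^bsub>G\<^esub> g) (y \<otimes>\<^bsub>A\<^esub> x) = hpart (h \<otimes>\<^bsub>G\<^esub> g) (\<Oplus>\<^bsub>A\<^esub>g'\<in>hsupp x. y \<otimes>\<^bsub>A\<^esub> hpart g' x)"
    using A.finsum_rdistr[OF fin(1) yc clo] hpart_sum[OF x] by simp
  also have "\<dots> = (\<Oplus>\<^bsub>A\<^esub>g'\<in>hsupp x. hpart (h \<otimes>\<^bsub>G\<^esub> g) (y \<otimes>\<^bsub>A\<^esub> hpart g' x))"
    using clo yc g h by (intro hpart_finsum) auto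
  also have "\<dots> = (\<Oplus>\<^bsub>A\<^esub>g'\<in>hsupp x. if g' = g then y \<otimes>\<^bsub>A\<^esub> hpart g' x else \<zero>\<^bsub>A\<^esub>)"
  proof (rule A.finsum_cong'[OF refl])
    fix g' assume "g' \<in> hsupp x"
    then have g': "g' \<in> carrier G"
      using fin(2) by blast
    have "y \<otimes>\<^bsub>A\<^esub> hpart g' x \<in> \<Gamma> (h \<otimes>\<^bsub>G\<^esub> g')"
      using component_mult[OF h g' y hpart_in[OF x g']] .
    then show "hpart (h \<otimes>\<^bsub>G\<^esub> g) (y \<otimes>\<^bsub>A\<^esub> hpart g' x)
        = (if g' = g then y \<otimes>\<^bsub>A\<^esub> hpart g' x else \<zero>\<^bsub>A\<^esub>)"
      using hpart_homogeneous[of "y \<otimes>\<^bsub>A\<^esub> hpart g' x" "h \<otimes>\<^bsub>G\<^esub> g'" "h \<otimes>\<^bsub>G\<^esub> g"] g g' h by auto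
  qed (use clo yc in \<open>auto simp: Pi_def\<close>)
  also have "\<dots> = y \<otimes>\<^bsub>A\<^esub> hpart g x"
    by (rule finsum_delta) (use fin clo yc g in \<open>auto simp: hsupp_def\<close>)
  finally show ?thesis .
qed

lemma hpart_mult_right:
  assumes y: "y \<in> \<Gamma> h" and x: "x \<in> carrier A" and g: "g \<in> carrier G" and h: "h \<in> carrier G"
  shows "hpart (g \<otimes>\<^bsub>G\<^esub> h) (x \<otimes>\<^bsub>A\<^esub> y) = hpart g x \<otimes>\<^bsub>A\<^esub> y"
proof -
  have fin: "finite (hsupp x)" "hsupp x \<subseteq> carrier G" and yc: "y \<in> carrier A"
    using finite_hsupp[OF x] component_closed[OF h y] by (auto simp: hsupp_def)
  have clo: "(\<lambda>g. hpart g x) \<in> hsupp x \<rightarrow> carrier A"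
    using fin(2) x hpart_closed by auto
  have "hpart (g \<otimes>\<^bsub>G\<^esub> h) (x \<otimes>\<^bsub>A\<^esub> y) = hpart (g \<otimes>\<^bsub>G\<^esub> h) (\<Oplus>\<^bsub>A\<^esub>g'\<in>hsupp x. hpart g' x \<otimes>\<^bsub>A\<^esub> y)"
    using A.finsum_ldistr[OF fin(1) yc clo] hpart_sum[OF x] by simp
  also have "\<dots> = (\<Oplus>\<^bsub>A\<^esub>g'\<in>hsupp x. hpart (g \<otimes>\<^bsub>G\<^esub> h) (hpart g' x \<otimes>\<^bsub>A\<^esub> y))"
    using clo yc g h by (intro hpart_finsum) auto
  also have "\<dots> = (\<Oplus>\<^bsub>A\<^esub>g'\<in>hsupp x. if g' = g then hpart g' x \<otimes>\<^bsub>A\<^esub> y else \<zero>\<^bsub>A\<^esub>)"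
  proof (rule A.finsum_cong'[OF refl])
    fix g' assume "g' \<in> hsupp x"
    then have g': "g' \<in> carrier G"
      using fin(2) by blast
    have "hpart g' x \<otimes>\<^bsub>A\<^esub> y \<in> \<Gamma> (g' \<otimes>\<^bsub>G\<^esub> h)"
      using component_mult[OF g' h hpart_in[OF x g'] y] .
    then show "hpart (g \<otimes>\<^bsub>G\<^esub> h) (hpart g' x \<otimes>\<^bsub>A\<^esub> y)
        = (if g' = g then hpart g' x \<otimes>\<^bsub>A\<^esub> y else \<zero>\<^bsub>A\<^esub>)"
      using hpart_homogeneous[of "hpart g' x \<otimes>\<^bsub>A\<^esub> y" "g' \<otimes>\<^bsub>G\<^esub> h" "g \<otimes>\<^bsub>G\<^esub> h"] g g' h by auto
  qed (use clo yc in \<open>auto simp: Pi_def\<close>)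
  also have "\<dots> = hpart g x \<otimes>\<^bsub>A\<^esub> y"
    by (rule finsum_delta) (use fin clo yc g in \<open>auto simp: hsupp_def\<close>)
  finally show ?thesis .
qed

lemma hpart_nonzero: 
  assumes "a \<in> carrier A" "a \<noteq> \<zero>\<^bsub>A\<^esub>"
  obtains g where "g \<in> carrier G" "hpart g a \<noteq> \<zero>\<^bsub>A\<^esub>"
proof -
  have "hsupp a \<noteq> {}"
    using hpart_sum[OF assms(1)] assms(2) by auto
  then show thesis
    using that by (auto simp: hsupp_def)
qed

text \<open>The component \<open>e\<close> of the identity in trivial degree satisfies
  \<open>x e = x\<close> for homogeneous \<open>x\<close>, hence for every component of the
  identity. Summing these gives that \<open>1 e\<close>, which is \<open>e\<close>, equals the
  identity.\<close>

lemma one_in_component: "\<one>\<^bsub>A\<^esub> \<in> \<Gamma> \<one>\<^bsub>G\<^esub>"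
proof -
  define e where "e = hpart \<one>\<^bsub>G\<^esub> \<one>\<^bsub>A\<^esub>"
  have e: "e \<in> \<Gamma> \<one>\<^bsub>G\<^esub>" "e \<in> carrier A"
    unfolding e_def using hpart_in hpart_closed by auto
  have hom: "x \<otimes>\<^bsub>A\<^esub> e = x" if "x \<in> \<Gamma> g" "g \<in> carrier G" for x g
    using hpart_mult_left[OF that(1) A.one_closed G.one_closed that(2)]
      hpart_homogeneous[OF that(1) that(2) that(2)] component_closed[OF that(2,1)] that(2)
    by (simp add: e_def)
  have clo: "(\<lambda>g. hpart g \<one>\<^bsub>A\<^esub>) \<in> hsupp \<one>\<^bsub>A\<^esub> \<rightarrow> carrier A"
    using hpart_closed by (auto simp: hsupp_def)
  have "\<one>\<^bsub>A\<^esub> \<otimes>\<^bsub>A\<^esub> e = (\<Oplus>\<^bsub>A\<^esub>g\<in>hsupp \<one>\<^bsub>A\<^esub>. hpart g \<one>\<^bsub>A\<^esub> \<otimes>\<^bsub>A\<^esub> e)"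
    using A.finsum_ldistr[OF finite_hsupp[OF A.one_closed] e(2) clo] hpart_sum[of "\<one>\<^bsub>A\<^esub>"] by simp
  also have "\<dots> = (\<Oplus>\<^bsub>A\<^esub>g\<in>hsupp \<one>\<^bsub>A\<^esub>. hpart g \<one>\<^bsub>A\<^esub>)"
    using clo hom[OF hpart_in[OF A.one_closed]] by (intro A.finsum_cong') (auto simp: hsupp_def)
  also have "\<dots> = \<one>\<^bsub>A\<^esub>"
    using hpart_sum[of "\<one>\<^bsub>A\<^esub>"] by simp
  finally show ?thesis
    using e by simp
qed

end

text \<open>Recognises a grading by additive projections \<open>P g\<close> onto the components. It
  is applied to the matrix grading, to the relabelling by natural numbers and to the
  corners.\<close>

lemma group_gradingI:
  fixes A :: "('f::field, 'a) module"
  assumes "comm_group G" "abelian_group A"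
    and sub: "\<And>g. g \<in> carrier G \<Longrightarrow> submodule (\<Gamma> g) scalar_ring A"
    and mult: "\<And>g h x y. g \<in> carrier G \<Longrightarrow> h \<in> carrier G \<Longrightarrow> x \<in> \<Gamma> g \<Longrightarrow> y \<in> \<Gamma> h
        \<Longrightarrow> x \<otimes>\<^bsub>A\<^esub> y \<in> \<Gamma> (g \<otimes>\<^bsub>G\<^esub> h)"
    and P_in: "\<And>g a. g \<in> carrier G \<Longrightarrow> a \<in> carrier A \<Longrightarrow> P g a \<in> \<Gamma> g"
    and P_add: "\<And>g a b. g \<in> carrier G \<Longrightarrow> a \<in> carrier A \<Longrightarrow> b \<in> carrier A
        \<Longrightarrow> P g (a \<oplus>\<^bsub>A\<^esub> b) = P g a \<oplus>\<^bsub>A\<^esub> P g b"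
    and P_hom: "\<And>g h x. g \<in> carrier G \<Longrightarrow> h \<in> carrier G \<Longrightarrow> x \<in> \<Gamma> h
        \<Longrightarrow> P g x = (if g = h then x else \<zero>\<^bsub>A\<^esub>)"
    and P_fin: "\<And>a. a \<in> carrier A \<Longrightarrow> finite {g \<in> carrier G. P g a \<noteq> \<zero>\<^bsub>A\<^esub>}"
    and P_sum: "\<And>a. a \<in> carrier A \<Longrightarrow> (\<Oplus>\<^bsub>A\<^esub>g\<in>{g \<in> carrier G. P g a \<noteq> \<zero>\<^bsub>A\<^esub>}. P g a) = a"
  shows "group_grading G A \<Gamma>"
proof -
  interpret G: comm_group G by fact
  interpret A: abelian_group A by fact
  have clo: "\<Gamma> g \<subseteq> carrier A" if "g \<in> carrier G" for g
    using subgroup.subset[OF submodule.axioms(1)[OF sub[OF that]]] by simp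
  have P_zero: "P g \<zero>\<^bsub>A\<^esub> = \<zero>\<^bsub>A\<^esub>" if "g \<in> carrier G" for g
    using P_hom[OF that that, of "\<zero>\<^bsub>A\<^esub>"]
      subgroup.one_closed[OF submodule.axioms(1)[OF sub[OF that]]] by simp
  have P_clo: "P g a \<in> carrier A" if "g \<in> carrier G" "a \<in> carrier A" for g a
    using P_in[OF that] clo[OF that(1)] by blast
  have P_finsum: "P g (finsum A f I) = (\<Oplus>\<^bsub>A\<^esub>i\<in>I. P g (f i))"
    if "g \<in> carrier G" "f \<in> I \<rightarrow> carrier A" for g f and I :: "'b set"
    using that(2)
  proof (induction I rule: infinite_finite_induct)
    case (insert i I)
    then have "(\<lambda>i. P g (f i)) \<in> I \<rightarrow> carrier A" "P g (f i) \<in> carrier A"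
      using P_clo that(1) by auto
    then show ?case
      using insert that(1) by (auto simp: P_add)
  qed (simp_all add: A.finsum_infinite P_zero that(1))
  have "\<exists>!c. c \<in> (\<Pi>\<^sub>E g\<in>carrier G. \<Gamma> g) \<and> finite {g \<in> carrier G. c g \<noteq> \<zero>\<^bsub>A\<^esub>} \<and>
        a = (\<Oplus>\<^bsub>A\<^esub>g\<in>{g \<in> carrier G. c g \<noteq> \<zero>\<^bsub>A\<^esub>}. c g)" if a: "a \<in> carrier A" for a
  proof (rule ex1I[where a = "\<lambda>g\<in>carrier G. P g a"], goal_cases)
    case 1
    have eq: "{g \<in> carrier G. (\<lambda>g\<in>carrier G. P g a) g \<noteq> \<zero>\<^bsub>A\<^esub>} = {g \<in> carrier G. P g a \<noteq> \<zero>\<^bsub>A\<^esub>}"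
      by auto
    have "(\<Oplus>\<^bsub>A\<^esub>g\<in>{g \<in> carrier G. P g a \<noteq> \<zero>\<^bsub>A\<^esub>}. (\<lambda>g\<in>carrier G. P g a) g) = a"
      using P_sum[OF a] P_clo[OF _ a] by (subst (2) P_sum[OF a, symmetric], intro A.finsum_cong') auto
    then show ?case
      unfolding eq using P_fin[OF a] P_in[OF _ a] by auto
  next
    case (2 c)
    let ?S = "{g \<in> carrier G. c g \<noteq> \<zero>\<^bsub>A\<^esub>}"
    have c: "c g \<in> \<Gamma> g" "c g \<in> carrier A" if "g \<in> carrier G" for g
      using 2 that clo[OF that] by auto
    \<comment> \<open>Uniqueness: applying the additive map \<open>P h\<close> to a competing
      decomposition kills every term except the one of degree \<open>h\<close>.\<close>
    have "P h a = c h" if h: "h \<in> carrier G" for h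
    proof -
      have "P h a = P h (finsum A c ?S)"
        using 2 by simp
      also have "\<dots> = (\<Oplus>\<^bsub>A\<^esub>g\<in>?S. P h (c g))"
        using c by (intro P_finsum h) auto
      also have "\<dots> = (\<Oplus>\<^bsub>A\<^esub>g\<in>?S. if h = g then c g else \<zero>\<^bsub>A\<^esub>)"
        using c P_hom h by (intro A.finsum_cong') auto
      also have "\<dots> = c h"
      proof (cases "h \<in> ?S")
        case True
        then show ?thesis
          using 2 c by (intro A.finsum_singleton) auto
      next
        case False
        then have "(\<Oplus>\<^bsub>A\<^esub>g\<in>?S. if h = g then c g else \<zero>\<^bsub>A\<^esub>) = \<zero>\<^bsub>A\<^esub>"
          by (intro A.add.finprod_one_eqI) auto
        then show ?thesis
          using False h by simp
      qed
      finally show ?thesis .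
    qed
    moreover have "c \<in> extensional (carrier G)"
      using 2 by (auto simp: PiE_def)
    ultimately show ?case
      by (intro extensionalityI[where A = "carrier G"]) auto
  qed
  then show ?thesis
    unfolding group_grading_def using assms(1) sub mult by auto
qed

section \<open>Matrix algebras\<close>

lemma mat_algebra_simps [simp]:
  "carrier (mat_algebra scale k) = carrier_mat k k"
  "X \<otimes>\<^bsub>mat_algebra scale k\<^esub> Y = X * Y"
  "X \<oplus>\<^bsub>mat_algebra scale k\<^esub> Y = X + Y"
  "\<one>\<^bsub>mat_algebra scale k\<^esub> = 1\<^sub>m k"
  "\<zero>\<^bsub>mat_algebra scale k\<^esub> = 0\<^sub>m k k"
  "c \<odot>\<^bsub>mat_algebra scale k\<^esub> X = map_mat (scale c) X"
  by (simp_all add: mat_algebra_def)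

lemma type_algebra_simps [simp]:
  "carrier (type_algebra scale) = UNIV"
  "x \<otimes>\<^bsub>type_algebra scale\<^esub> y = x * y"
  "x \<oplus>\<^bsub>type_algebra scale\<^esub> y = x + y"
  "\<one>\<^bsub>type_algebra scale\<^esub> = 1"
  "\<zero>\<^bsub>type_algebra scale\<^esub> = 0"
  "c \<odot>\<^bsub>type_algebra scale\<^esub> x = scale c x"
  by (simp_all add: type_algebra_def)

lemma cring_scalar_ring: "cring (scalar_ring :: 'f::field ring)"
proof -
  have "abelian_group (scalar_ring :: 'f ring)"
  proof (rule abelian_groupI)
    fix x :: 'f assume "x \<in> carrier scalar_ring"
    show "\<exists>y\<in>carrier scalar_ring. y \<oplus>\<^bsub>scalar_ring\<^esub> x = \<zero>\<^bsub>scalar_ring\<^esub>"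
      by (rule bexI[of _ "- x"]) auto
  qed (auto simp: algebra_simps)
  moreover have "comm_monoid (scalar_ring :: 'f ring)"
    by (rule comm_monoidI) (auto simp: algebra_simps)
  ultimately show ?thesis
    by (rule cringI) (auto simp: algebra_simps)
qed

lemma ring_type_algebra: "ring (type_algebra scale)"
proof (rule ringI)
  show "abelian_group (type_algebra scale)"
  proof (rule abelian_groupI)
    fix x assume "x \<in> carrier (type_algebra scale)"
    show "\<exists>y\<in>carrier (type_algebra scale). y \<oplus>\<^bsub>type_algebra scale\<^esub> x = \<zero>\<^bsub>type_algebra scale\<^esub>"
      by (rule bexI[of _ "- x"]) auto
  qed (auto simp: algebra_simps)
  show "monoid (type_algebra scale)"
    by (rule monoidI) (auto simp: algebra_simps)
qed (auto simp: algebra_simps)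

lemma ring_mat_algebra: "ring (mat_algebra scale k)"
proof (rule ringI)
  show "abelian_group (mat_algebra scale k)"
  proof (rule abelian_groupI)
    fix X assume "X \<in> carrier (mat_algebra scale k)"
    then show "\<exists>Y\<in>carrier (mat_algebra scale k). Y \<oplus>\<^bsub>mat_algebra scale k\<^esub> X = \<zero>\<^bsub>mat_algebra scale k\<^esub>"
      by (intro bexI[of _ "- X"]) auto
  qed (auto intro: comm_add_mat)
  show "monoid (mat_algebra scale k)"
    by (rule monoidI) auto
qed (auto simp: add_mult_distrib_mat mult_add_distrib_mat)

context assoc_algebra
begin

lemma module_type_algebra: "module scalar_ring (type_algebra scale)"
  using ring.is_abelian_group[OF ring_type_algebra]
  by (intro moduleI cring_scalar_ring)
    (auto simp: scale_left_distrib scale_right_distrib)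

lemma module_mat_algebra: "module scalar_ring (mat_algebra scale k)"
  using ring.is_abelian_group[OF ring_mat_algebra]
  by (intro moduleI cring_scalar_ring)
    (auto simp: scale_left_distrib scale_right_distrib)

end

lemma finsum_type_algebra: "finsum (type_algebra scale) f S = sum f S"
proof -
  interpret ring "type_algebra scale"
    by (rule ring_type_algebra)
  show ?thesis
    by (induction S rule: infinite_finite_induct) (simp_all add: finsum_infinite)
qed

lemma finsum_mat_algebra_closed:
  "f \<in> S \<rightarrow> carrier_mat k k \<Longrightarrow> finsum (mat_algebra scale k) f S \<in> carrier_mat k k"
  using abelian_monoid.finsum_closed[of "mat_algebra scale k" f S]
    ring.is_abelian_group[OF ring_mat_algebra, of scale k] abelian_group.axioms(1) by force

lemma finsum_mat_algebra_index:
  assumes "f \<in> S \<rightarrow> carrier_mat k k" "i < k" "j < k"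
  shows "finsum (mat_algebra scale k) f S $$ (i, j) = (\<Sum>g\<in>S. f g $$ (i, j))"
  using assms(1)
proof (induction S rule: infinite_finite_induct)
  interpret ring "mat_algebra scale k"
    by (rule ring_mat_algebra)
  {
    case (infinite S)
    then show ?case
      using assms by (simp add: finsum_infinite)
  next
    case empty
    then show ?case
      using assms by simp
  next
    case (insert g S)
    then have "f \<in> S \<rightarrow> carrier_mat k k" "f g \<in> carrier_mat k k"
      by auto
    then show ?case
      using insert assms finsum_mat_algebra_closed[of f S k scale] by simp
  }
qed

section \<open>Matrix units and their products\<close>

lemma mult_mat_index:
  "X \<in> carrier_mat k k \<Longrightarrow> Y \<in> carrier_mat k k \<Longrightarrow> i < k \<Longrightarrow> j < k
    \<Longrightarrow> (X * Y) $$ (i, j) = (\<Sum>l<k. X $$ (i, l) * Y $$ (l, j))"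
  by (auto simp: scalar_prod_def atLeast0LessThan)

lemma unit_mat_closed [simp]: "unit_mat k i j d \<in> carrier_mat k k"
  by (simp add: unit_mat_def)

lemma unit_mat_dim [simp]: "dim_row (unit_mat k i j d) = k" "dim_col (unit_mat k i j d) = k"
  by (simp_all add: unit_mat_def)

lemma unit_mat_index [simp]:
  "a < k \<Longrightarrow> b < k \<Longrightarrow> unit_mat k i j d $$ (a, b) = (if a = i \<and> b = j then d else 0)"
  by (simp add: unit_mat_def)

lemma mat_eqI:
  "X \<in> carrier_mat k k \<Longrightarrow> Y \<in> carrier_mat k k \<Longrightarrow>
    (\<And>a b. a < k \<Longrightarrow> b < k \<Longrightarrow> X $$ (a, b) = Y $$ (a, b)) \<Longrightarrow> X = Y"
  by (intro eq_matI) auto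

lemma unit_mat_mult_index:
  fixes d :: "'d::semiring_1"
  assumes "X \<in> carrier_mat k k" "j < k" "a < k" "b < k"
  shows "(unit_mat k i j d * X) $$ (a, b) = (if a = i then d * X $$ (j, b) else 0)"
proof -
  have "(unit_mat k i j d * X) $$ (a, b) = (\<Sum>l<k. if l = j then (if a = i then d * X $$ (j, b) else 0) else 0)"
    unfolding mult_mat_index[OF unit_mat_closed assms(1,3,4)] using assms by (intro sum.cong) auto
  then show ?thesis
    using assms(2) by simp
qed

lemma mult_unit_mat_index:
  fixes d :: "'d::semiring_1"
  assumes "X \<in> carrier_mat k k" "i < k" "a < k" "b < k"
  shows "(X * unit_mat k i j d) $$ (a, b) = (if b = j then X $$ (a, i) * d else 0)"
proof -
  have "(X * unit_mat k i j d) $$ (a, b) = (\<Sum>l<k. if l = i then (if b = j then X $$ (a, i) * d else 0) else 0)"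
    unfolding mult_mat_index[OF assms(1) unit_mat_closed assms(3,4)] using assms by (intro sum.cong) auto
  then show ?thesis
    using assms(2) by simp
qed

lemma unit_mat_mult_unit_mat:
  fixes d d' :: "'d::semiring_1"
  assumes "i < k" "j < k" "i' < k" "j' < k"
  shows "unit_mat k i j d * unit_mat k i' j' d' = (if j = i' then unit_mat k i j' (d * d') else 0\<^sub>m k k)"
proof (rule mat_eqI)
  show "unit_mat k i j d * unit_mat k i' j' d' \<in> carrier_mat k k"
    by (rule mult_carrier_mat[OF unit_mat_closed unit_mat_closed])
  fix a b assume ab: "a < k" "b < k"
  show "(unit_mat k i j d * unit_mat k i' j' d') $$ (a, b)
      = (if j = i' then unit_mat k i j' (d * d') else 0\<^sub>m k k) $$ (a, b)"
    unfolding unit_mat_mult_index[OF unit_mat_closed assms(2) ab] using assms ab by simp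
qed simp

lemma unit_mat_add: "unit_mat k i j (d + d') = unit_mat k i j d + unit_mat k i j (d' :: 'd::monoid_add)"
  by (rule mat_eqI[of _ k]) auto

lemma unit_mat_eq_zero_iff: "i < k \<Longrightarrow> j < k \<Longrightarrow> unit_mat k i j d = 0\<^sub>m k k \<longleftrightarrow> d = 0"
proof
  assume "i < k" "j < k" "unit_mat k i j d = 0\<^sub>m k k"
  then have "unit_mat k i j d $$ (i, j) = 0\<^sub>m k k $$ (i, j)"
    by simp
  then show "d = 0"
    using \<open>i < k\<close> \<open>j < k\<close> by simp
qed (auto intro!: mat_eqI)

text \<open>Reduces membership of a matrix in a subspace to membership of its matrix units; this is
  how spans are handled for both gradings.\<close>

lemma mat_decompose:
  fixes X :: "'d::ring_1 mat"
  assumes "X \<in> carrier_mat k k"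
  shows "X = (\<Oplus>\<^bsub>mat_algebra scale k\<^esub>p\<in>{..<k} \<times> {..<k}. unit_mat k (fst p) (snd p) (X $$ p))"
proof (rule mat_eqI[OF assms])
  let ?f = "\<lambda>p. unit_mat k (fst p) (snd p) (X $$ p)"
  show "finsum (mat_algebra scale k) ?f ({..<k} \<times> {..<k}) \<in> carrier_mat k k"
    by (rule finsum_mat_algebra_closed) auto
  fix a b assume ab: "a < k" "b < k"
  have "finsum (mat_algebra scale k) ?f ({..<k} \<times> {..<k}) $$ (a, b)
      = (\<Sum>p\<in>{..<k} \<times> {..<k}. if p = (a, b) then X $$ (a, b) else 0)"
    using ab by (subst finsum_mat_algebra_index) (auto intro!: sum.cong simp: prod_eq_iff)
  then show "X $$ (a, b) = finsum (mat_algebra scale k) ?f ({..<k} \<times> {..<k}) $$ (a, b)"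
    using ab by simp
qed

section \<open>Degrees of matrix units\<close>

text \<open>The index involution \<sigma> of the overview. Parity is taken after subtracting
  \<open>q\<close>, since the pairs start at index \<open>q\<close>.\<close>

definition partner :: "nat \<Rightarrow> nat \<Rightarrow> nat" where
  "partner q i = (if i < q then i else if even (i - q) then i + 1 else i - 1)"

lemma partner_simps [simp]:
  "i < q \<Longrightarrow> partner q i = i"
  "partner q (q + 2 * j) = q + 2 * j + 1"
  "partner q (Suc (q + 2 * j)) = q + 2 * j"
  by (auto simp: partner_def)

lemma partner_cases:
  obtains "i < q" | j where "i = q + 2 * j" | j where "i = Suc (q + 2 * j)"
proof (cases "i < q")
  case False
  then have "i = q + 2 * ((i - q) div 2) \<or> i = Suc (q + 2 * ((i - q) div 2))"
    by presburger
  then show thesis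
    using that by blast
qed

lemma partner_partner [simp]: "partner q (partner q i) = i"
  by (rule partner_cases[of i q]) auto

lemma partner_less: "i < q + 2 * s \<Longrightarrow> partner q i < q + 2 * s"
  by (rule partner_cases[of i q]) auto

lemma partner_less_iff: "partner q i < q \<longleftrightarrow> i < q"
  by (rule partner_cases[of i q]) auto

lemma partner_eq_iff: "partner q i = i \<longleftrightarrow> i < q"
  by (rule partner_cases[of i q]) auto

locale degree_group = T: comm_group T for T :: "'t monoid" +
  fixes q s :: nat and ts :: "'t list"
  assumes length_ts: "length ts = q" and ts_closed: "set ts \<subseteq> carrier T"
begin

abbreviation "k \<equiv> q + 2 * s"
abbreviation "F \<equiv> gt_free T q s"
abbreviation "R \<equiv> gt_relations T q s ts"
abbreviation "udeg \<equiv> unit_degree T q s ts"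

text \<open>The degree of the nonzero entry of \<Phi> in row \<open>i\<close>: the entries 1 and
  \<delta> of the blocks have trivial degree.\<close>

definition tau :: "nat \<Rightarrow> 't" where
  "tau i = (if i < q then ts ! i else \<one>\<^bsub>T\<^esub>)"

lemma tau_closed [simp]: "tau i \<in> carrier T"
  using ts_closed length_ts by (auto simp: tau_def)

lemma tau_partner [simp]: "tau (partner q i) = tau i"
  using partner_less_iff[of q i] by (auto simp: tau_def)

text \<open>One formula for both kinds of equated elements: for \<open>i < q\<close> the index is
  its own partner and the square appears, while the two members of a pair give the same
  element.\<close>

definition rel :: "nat \<Rightarrow> (nat \<Rightarrow>\<^sub>0 int) \<times> 't" where
  "rel i = (frag_of i + frag_of (partner q i), inv\<^bsub>T\<^esub> (tau i))"

lemma gt_equated_eq: "gt_equated T q s ts = rel ` {..<k}"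
proof (intro equalityI subsetI)
  fix x assume "x \<in> gt_equated T q s ts"
  then consider i where "i < q" "x = (frag_of i + frag_of i, inv\<^bsub>T\<^esub> (ts ! i))"
    | j where "j < s" "x = (frag_of (q + 2 * j) + frag_of (q + 2 * j + 1), \<one>\<^bsub>T\<^esub>)"
    unfolding gt_equated_def by blast
  then show "x \<in> rel ` {..<k}"
  proof cases
    case 1
    then show ?thesis
      by (intro image_eqI[of _ _ i]) (auto simp: rel_def tau_def)
  next
    case 2
    then show ?thesis
      by (intro image_eqI[of _ _ "q + 2 * j"]) (auto simp: rel_def tau_def)
  qed
next
  fix x assume "x \<in> rel ` {..<k}"
  then obtain i where i: "i < k" "x = rel i"
    by blast
  show "x \<in> gt_equated T q s ts"
  proof (cases "i < q")
    case True
    then show ?thesis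
      using i by (auto simp: gt_equated_def rel_def tau_def)
  next
    case False
    then obtain j where "i = q + 2 * j \<or> i = Suc (q + 2 * j)"
      using partner_cases[of i q] by metis
    then show ?thesis
      using i by (auto simp: gt_equated_def rel_def tau_def add.commute)
  qed
qed

section \<open>The free group, its relations and the quotient\<close>

lemma comm_group_gt_free: "comm_group F"
proof (rule group.group_comm_groupI)
  show "group F"
    unfolding gt_free_def by (intro DirProd_group) auto
  show "x \<otimes>\<^bsub>F\<^esub> y = y \<otimes>\<^bsub>F\<^esub> x" if "x \<in> carrier F" "y \<in> carrier F" for x y
    using that unfolding gt_free_def by (auto simp: T.m_comm mult_DirProd' add.commute)
qed

sublocale F: comm_group F
  by (rule comm_group_gt_free)

lemma carrier_gt_free: "carrier F = {f. Poly_Mapping.keys f \<subseteq> {..<k}} \<times> carrier T"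
  by (auto simp: gt_free_def)

lemma mult_gt_free [simp]: "(f, t) \<otimes>\<^bsub>F\<^esub> (f', t') = (f + f', t \<otimes>\<^bsub>T\<^esub> t')"
  by (simp add: gt_free_def)

lemma inv_gt_free: "(f, t) \<in> carrier F \<Longrightarrow> inv\<^bsub>F\<^esub> (f, t) = (- f, inv\<^bsub>T\<^esub> t)"
  unfolding gt_free_def by (subst inv_DirProd) auto

lemma frag_in_carrier:
  assumes "i < k" "j < k" "t \<in> carrier T"
  shows "(frag_of i + frag_of j, t) \<in> carrier F" "(frag_of i - frag_of j, t) \<in> carrier F"
  using assms keys_add[of "frag_of i" "frag_of j"] keys_diff[of "frag_of i" "frag_of j"]
  by (auto simp: carrier_gt_free subset_iff)

lemma rel_closed: "i < k \<Longrightarrow> rel i \<in> carrier F"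
  unfolding rel_def using partner_less by (intro frag_in_carrier) auto

lemma relations_gens:
  "{x \<otimes>\<^bsub>F\<^esub> inv\<^bsub>F\<^esub> y | x y. x \<in> gt_equated T q s ts \<and> y \<in> gt_equated T q s ts} \<subseteq> carrier F"
  using rel_closed by (auto simp: gt_equated_eq)

lemma subgroup_relations: "subgroup R F"
  unfolding gt_relations_def by (rule F.generate_is_subgroup[OF relations_gens])

lemma normal_relations: "R \<lhd> F"
  using subgroup_relations by (simp add: F.normal_iff_subgroup)

lemma comm_group_G_tilde: "comm_group (G_tilde T q s ts)"
  unfolding G_tilde_def by (rule F.abelian_FactGroup[OF subgroup_relations])

lemma rel_diff_in_relations: "i < k \<Longrightarrow> j < k \<Longrightarrow> rel i \<otimes>\<^bsub>F\<^esub> inv\<^bsub>F\<^esub> rel j \<in> R"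
  unfolding gt_relations_def gt_equated_eq by (rule generate.incl) blast

lemma unit_degree_closed:
  "i < k \<Longrightarrow> j < k \<Longrightarrow> t \<in> carrier T \<Longrightarrow> udeg i j t \<in> carrier (G_tilde T q s ts)"
  unfolding unit_degree_def G_tilde_def using frag_in_carrier(2) by (auto simp: carrier_FactGroup)

lemma unit_degree_mult:
  assumes "i < k" "j < k" "l < k" "t \<in> carrier T" "t' \<in> carrier T"
  shows "udeg i j t \<otimes>\<^bsub>G_tilde T q s ts\<^esub> udeg j l t' = udeg i l (t \<otimes>\<^bsub>T\<^esub> t')"
  unfolding unit_degree_def G_tilde_def
  using normal.rcos_sum[OF normal_relations frag_in_carrier(2)[OF assms(1,2,4)]
      frag_in_carrier(2)[OF assms(2,3,5)]] by simp

section \<open>Coincidences among the degrees of matrix units\<close>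

lemma unit_degree_eq_iff:
  assumes "i < k" "j < k" "t \<in> carrier T" "i' < k" "j' < k" "t' \<in> carrier T"
  shows "udeg i j t = udeg i' j' t' \<longleftrightarrow>
    (frag_of i - frag_of j - (frag_of i' - frag_of j'), t \<otimes>\<^bsub>T\<^esub> inv\<^bsub>T\<^esub> t') \<in> R"
proof -
  let ?x = "(frag_of i - frag_of j, t)" and ?y = "(frag_of i' - frag_of j', t')"
  have x: "?x \<in> carrier F" and y: "?y \<in> carrier F"
    using frag_in_carrier assms by auto
  have "udeg i j t = udeg i' j' t' \<longleftrightarrow> ?x \<in> R #>\<^bsub>F\<^esub> ?y"
    unfolding unit_degree_def
    using F.repr_independence[OF _ y subgroup_relations] F.rcos_self[OF x subgroup_relations] by metis
  also have "\<dots> \<longleftrightarrow> ?x \<otimes>\<^bsub>F\<^esub> inv\<^bsub>F\<^esub> ?y \<in> R"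
    using subgroup.rcos_module[OF subgroup_relations F.is_group y x] by simp
  also have "?x \<otimes>\<^bsub>F\<^esub> inv\<^bsub>F\<^esub> ?y
      = (frag_of i - frag_of j - (frag_of i' - frag_of j'), t \<otimes>\<^bsub>T\<^esub> inv\<^bsub>T\<^esub> t')"
    using inv_gt_free[OF y] by simp
  finally show ?thesis .
qed

text \<open>An explicit subgroup containing every \<open>rel i\<close>, and therefore the group
  \<open>R\<close> generated by their quotients. Each relator with \<open>i < q\<close> has free
  part twice a generator and \<open>T\<close>-part the inverse of \<open>tau i\<close>, so the
  \<open>T\<close>-part is recovered from the halved coefficients. Membership is thus a checkable
  necessary condition for two degrees to coincide.\<close>

definition invariant :: "((nat \<Rightarrow>\<^sub>0 int) \<times> 't) set" where
  "invariant = {(f, u). (f, u) \<in> carrier F \<and>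
     (\<forall>i<q. even (Poly_Mapping.lookup f i)) \<and> (\<forall>i. Poly_Mapping.lookup f (partner q i) = Poly_Mapping.lookup f i) \<and>
     u = (\<Otimes>\<^bsub>T\<^esub>i\<in>{..<q}. tau i [^]\<^bsub>T\<^esub> (- (Poly_Mapping.lookup f i div 2)))}"

lemma subgroup_invariant: "subgroup invariant F"
proof (rule F.subgroupI)
  show "invariant \<subseteq> carrier F"
    by (auto simp: invariant_def)
  have "(0, \<one>\<^bsub>T\<^esub>) \<in> invariant"
    by (auto simp: invariant_def carrier_gt_free)
  then show "invariant \<noteq> {}"
    by blast
next
  fix x assume "x \<in> invariant"
  then obtain f u where x: "x = (f, u)" "(f, u) \<in> carrier F"
    and ev: "\<forall>i<q. even (Poly_Mapping.lookup f i)" and sym: "\<forall>i. Poly_Mapping.lookup f (partner q i) = Poly_Mapping.lookup f i"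
    and u: "u = (\<Otimes>\<^bsub>T\<^esub>i\<in>{..<q}. tau i [^]\<^bsub>T\<^esub> (- (Poly_Mapping.lookup f i div 2)))"
    by (auto simp: invariant_def)
  let ?v = "\<Otimes>\<^bsub>T\<^esub>i\<in>{..<q}. tau i [^]\<^bsub>T\<^esub> (- (Poly_Mapping.lookup (- f) i div 2))"
  have "?v \<otimes>\<^bsub>T\<^esub> u = (\<Otimes>\<^bsub>T\<^esub>i\<in>{..<q}. tau i [^]\<^bsub>T\<^esub> (- (Poly_Mapping.lookup (- f) i div 2)) \<otimes>\<^bsub>T\<^esub>
        tau i [^]\<^bsub>T\<^esub> (- (Poly_Mapping.lookup f i div 2)))"
    unfolding u by (rule T.finprod_multf[symmetric]) auto
  also have "\<dots> = \<one>\<^bsub>T\<^esub>"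
  proof (rule T.finprod_one_eqI)
    fix i assume "i \<in> {..<q}"
    \<comment> \<open>Evenness matters here: for odd coefficients the rounded halves of
      \<open>f\<close> and \<open>- f\<close> would not cancel.\<close>
    then have "- (Poly_Mapping.lookup (- f) i div 2) + - (Poly_Mapping.lookup f i div 2) = 0"
      using ev by (auto elim!: evenE)
    then show "tau i [^]\<^bsub>T\<^esub> (- (Poly_Mapping.lookup (- f) i div 2)) \<otimes>\<^bsub>T\<^esub> tau i [^]\<^bsub>T\<^esub> (- (Poly_Mapping.lookup f i div 2)) = \<one>\<^bsub>T\<^esub>"
      by (metis T.int_pow_mult int_pow_0 tau_closed)
  qed
  finally have "inv\<^bsub>T\<^esub> u = ?v"
    using x(2) by (intro T.inv_equality) (auto simp: carrier_gt_free)
  then show "inv\<^bsub>F\<^esub> x \<in> invariant"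
    using x ev sym F.inv_closed[OF x(2)] by (auto simp: invariant_def inv_gt_free)
next
  fix x y assume "x \<in> invariant" "y \<in> invariant"
  then obtain f u g v where x: "x = (f, u)" "(f, u) \<in> carrier F"
    and y: "y = (g, v)" "(g, v) \<in> carrier F"
    and ev: "\<forall>i<q. even (Poly_Mapping.lookup f i)" "\<forall>i<q. even (Poly_Mapping.lookup g i)"
    and sym: "\<forall>i. Poly_Mapping.lookup f (partner q i) = Poly_Mapping.lookup f i" "\<forall>i. Poly_Mapping.lookup g (partner q i) = Poly_Mapping.lookup g i"
    and u: "u = (\<Otimes>\<^bsub>T\<^esub>i\<in>{..<q}. tau i [^]\<^bsub>T\<^esub> (- (Poly_Mapping.lookup f i div 2)))"
    and v: "v = (\<Otimes>\<^bsub>T\<^esub>i\<in>{..<q}. tau i [^]\<^bsub>T\<^esub> (- (Poly_Mapping.lookup g i div 2)))"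
    by (auto simp: invariant_def)
  have "u \<otimes>\<^bsub>T\<^esub> v = (\<Otimes>\<^bsub>T\<^esub>i\<in>{..<q}. tau i [^]\<^bsub>T\<^esub> (- (Poly_Mapping.lookup f i div 2)) \<otimes>\<^bsub>T\<^esub>
        tau i [^]\<^bsub>T\<^esub> (- (Poly_Mapping.lookup g i div 2)))"
    unfolding u v by (rule T.finprod_multf[symmetric]) auto
  also have "\<dots> = (\<Otimes>\<^bsub>T\<^esub>i\<in>{..<q}. tau i [^]\<^bsub>T\<^esub> (- (Poly_Mapping.lookup (f + g) i div 2)))"
  proof (rule T.finprod_cong')
    fix i assume "i \<in> {..<q}"
    then have "- (Poly_Mapping.lookup f i div 2) + - (Poly_Mapping.lookup g i div 2) = - (Poly_Mapping.lookup (f + g) i div 2)"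
      using ev by (auto simp: lookup_add elim!: evenE)
    then show "tau i [^]\<^bsub>T\<^esub> (- (Poly_Mapping.lookup f i div 2)) \<otimes>\<^bsub>T\<^esub> tau i [^]\<^bsub>T\<^esub> (- (Poly_Mapping.lookup g i div 2))
        = tau i [^]\<^bsub>T\<^esub> (- (Poly_Mapping.lookup (f + g) i div 2))"
      by (metis T.int_pow_mult tau_closed)
  qed auto
  finally have "u \<otimes>\<^bsub>T\<^esub> v = (\<Otimes>\<^bsub>T\<^esub>i\<in>{..<q}. tau i [^]\<^bsub>T\<^esub> (- (Poly_Mapping.lookup (f + g) i div 2)))" .
  then show "x \<otimes>\<^bsub>F\<^esub> y \<in> invariant"
    using x y ev sym F.m_closed[OF x(2) y(2)] by (auto simp: invariant_def lookup_add)
qed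

text \<open>For \<open>i < q\<close> the free part has the single coefficient 2, whose half yields
  the inverse of \<open>tau i\<close>. Otherwise it is supported on a pair of indices from
  \<open>q\<close> on, where only symmetry is demanded and \<open>tau i\<close> is trivial.\<close>

lemma rel_in_invariant:
  assumes "i < k"
  shows "rel i \<in> invariant"
proof -
  let ?f = "frag_of i + frag_of (partner q i) :: nat \<Rightarrow>\<^sub>0 int"
  have lu: "Poly_Mapping.lookup ?f j = (if j = i then 1 else 0) + (if j = partner q i then 1 else 0)" for j
    by (simp add: lookup_add lookup_frag_of)
  have ev: "\<forall>j<q. even (Poly_Mapping.lookup ?f j)"
  proof (intro allI impI)
    fix j assume "j < q"
    then have "j = i \<longleftrightarrow> j = partner q i"
      using partner_less_iff[of q i] partner_eq_iff[of q i] by metis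
    then show "even (Poly_Mapping.lookup ?f j)"
      unfolding lu by simp
  qed
  have sym: "\<forall>j. Poly_Mapping.lookup ?f (partner q j) = Poly_Mapping.lookup ?f j"
  proof
    fix j
    have "partner q j = i \<longleftrightarrow> j = partner q i" "partner q j = partner q i \<longleftrightarrow> j = i"
      using partner_partner[of q j] partner_partner[of q i] by metis+
    then show "Poly_Mapping.lookup ?f (partner q j) = Poly_Mapping.lookup ?f j"
      unfolding lu by simp
  qed
  have "inv\<^bsub>T\<^esub> (tau i) = (\<Otimes>\<^bsub>T\<^esub>j\<in>{..<q}. tau j [^]\<^bsub>T\<^esub> (- (Poly_Mapping.lookup ?f j div 2)))"
  proof (cases "i < q")
    case True
    have "(\<Otimes>\<^bsub>T\<^esub>j\<in>{..<q}. tau j [^]\<^bsub>T\<^esub> (- (Poly_Mapping.lookup ?f j div 2)))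
        = (\<Otimes>\<^bsub>T\<^esub>j\<in>{..<q}. if j = i then inv\<^bsub>T\<^esub> (tau j) else \<one>\<^bsub>T\<^esub>)"
      unfolding lu using True by (intro T.finprod_cong') (auto simp: T.int_pow_neg)
    then show ?thesis
      using T.finprod_singleton_swap[of i "{..<q}" "\<lambda>j. inv\<^bsub>T\<^esub> (tau j)"] True by auto
  next
    case False
    then have "(\<Otimes>\<^bsub>T\<^esub>j\<in>{..<q}. tau j [^]\<^bsub>T\<^esub> (- (Poly_Mapping.lookup ?f j div 2))) = \<one>\<^bsub>T\<^esub>"
      unfolding lu using partner_less_iff[of q i] by (intro T.finprod_one_eqI) auto
    then show ?thesis
      using False by (simp add: tau_def)
  qed
  then show ?thesis
    using ev sym rel_closed[OF assms] unfolding invariant_def rel_def by auto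
qed

lemma relations_subset_invariant: "R \<subseteq> invariant"
  unfolding gt_relations_def gt_equated_eq
proof (rule F.generate_subgroup_incl[OF _ subgroup_invariant])
  show "{x \<otimes>\<^bsub>F\<^esub> inv\<^bsub>F\<^esub> y | x y. x \<in> rel ` {..<k} \<and> y \<in> rel ` {..<k}} \<subseteq> invariant"
    using rel_in_invariant subgroup.m_closed[OF subgroup_invariant]
      subgroup.m_inv_closed[OF subgroup_invariant] by blast
qed

text \<open>The quotient of the two elements has free part 0, so the product prescribing its
  \<open>T\<close>-part in \<open>invariant\<close> is empty of nontrivial factors. For
  \<open>i = j\<close> this expresses that \<open>T\<close> embeds in the quotient.\<close>

lemma unit_degree_inj:
  assumes "i < k" "j < k" "t \<in> carrier T" "t' \<in> carrier T" "udeg i j t = udeg i j t'"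
  shows "t = t'"
proof -
  have "(0, t \<otimes>\<^bsub>T\<^esub> inv\<^bsub>T\<^esub> t') \<in> invariant"
    using unit_degree_eq_iff[OF assms(1-3) assms(1,2,4)] assms(5) relations_subset_invariant by auto
  then have "t \<otimes>\<^bsub>T\<^esub> inv\<^bsub>T\<^esub> t' = \<one>\<^bsub>T\<^esub>"
    by (auto simp: invariant_def)
  then show ?thesis
    using T.inv_solve_right'[OF T.one_closed assms(3,4)] assms(3,4) by simp
qed

text \<open>The complete list of coincidences: both units are diagonal, they have the same position,
  or their positions are exchanged by the involution. It follows by comparing coefficients of the
  difference \<open>f\<close> of the free parts, using evenness below \<open>q\<close> and symmetry
  under \<open>partner\<close>.\<close>

lemma unit_degree_cases:
  assumes "i < k" "j < k" "t \<in> carrier T" "i' < k" "j' < k" "t' \<in> carrier T"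
    and "udeg i j t = udeg i' j' t'"
  obtains "i = j" "i' = j'" | "i = i'" "j = j'" | "i' = partner q j" "j' = partner q i"
proof -
  define f where "f = frag_of i - frag_of j - (frag_of i' - frag_of j')"
  have "(f, t \<otimes>\<^bsub>T\<^esub> inv\<^bsub>T\<^esub> t') \<in> invariant"
    unfolding f_def using unit_degree_eq_iff[OF assms(1-6)] assms(7) relations_subset_invariant by auto
  then have ev: "\<And>l. l < q \<Longrightarrow> even (Poly_Mapping.lookup f l)" and sym: "\<And>l. Poly_Mapping.lookup f (partner q l) = Poly_Mapping.lookup f l"
    by (auto simp: invariant_def)
  have lu: "Poly_Mapping.lookup f l = (if l = i then 1 else 0) - (if l = j then 1 else 0)
      - ((if l = i' then 1 else 0) - (if l = j' then 1 else 0))" for l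
    unfolding f_def by (simp add: lookup_minus lookup_frag_of)
  have pq: "l < q \<and> partner q l = l \<or> \<not> l < q \<and> partner q l \<noteq> l" for l
    using partner_eq_iff[of q l] by auto
  note * = ev[of i] ev[of j] ev[of i'] ev[of j'] sym[of i] sym[of j] sym[of i'] sym[of j']
      pq[of i] pq[of j] pq[of i'] pq[of j']
  consider "i = j" | "i \<noteq> j" "i = i'" | "i \<noteq> j" "i \<noteq> i'"
    by blast
  then show thesis
  proof cases
    case 1
    then have "i' = j'"
      using * unfolding lu by (auto split: if_splits)
    then show thesis
      using 1 that by blast
  next
    case 2
    then have "j = j'"
      using * unfolding lu by (auto split: if_splits)
    then show thesis
      using 2 that by blast
  next
    case 3
    \<comment> \<open>The coefficient of \<open>f\<close> at \<open>i\<close> is positive. For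
      \<open>i < q\<close> evenness demands a second positive contribution at \<open>i\<close>,
      otherwise symmetry demands one at the partner of \<open>i\<close>; only \<open>j'\<close> can
      supply it. The coefficient at \<open>j\<close> is then negative and determines
      \<open>i'\<close> in the same manner.\<close>
    then have "j' = partner q i"
      using ev[of i] sym[of i] pq[of i] unfolding lu by (auto split: if_splits)
    moreover have "j \<noteq> j'"
      using 3 ev[of i] sym[of i] pq[of i] unfolding lu by (auto split: if_splits)
    then have "i' = partner q j"
      using 3 ev[of j] sym[of j] pq[of j] unfolding lu by (auto split: if_splits)
    ultimately show thesis
      using that by blast
  qed
qed

text \<open>In the quotient \<open>rel i\<close> and \<open>rel j\<close> agree. Moving the
  generators with indices \<open>i\<close> and \<open>j\<close> to one side and their partners to
  the other gives the equation, with \<open>tau\<close> as the correction in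
  \<open>T\<close>.\<close>

lemma unit_degree_partner:
  assumes "i < k" "j < k" "t \<in> carrier T"
  shows "udeg (partner q j) (partner q i) (inv\<^bsub>T\<^esub> (tau j) \<otimes>\<^bsub>T\<^esub> t \<otimes>\<^bsub>T\<^esub> tau i) = udeg i j t"
proof -
  let ?t = "inv\<^bsub>T\<^esub> (tau j) \<otimes>\<^bsub>T\<^esub> t \<otimes>\<^bsub>T\<^esub> tau i"
  have "?t \<otimes>\<^bsub>T\<^esub> inv\<^bsub>T\<^esub> t = inv\<^bsub>T\<^esub> (tau j) \<otimes>\<^bsub>T\<^esub> tau i \<otimes>\<^bsub>T\<^esub> t \<otimes>\<^bsub>T\<^esub> inv\<^bsub>T\<^esub> t"
    using assms(3) T.m_comm[of t "tau i"] by (simp add: T.m_assoc)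
  also have "\<dots> = inv\<^bsub>T\<^esub> (tau j) \<otimes>\<^bsub>T\<^esub> tau i"
    using assms(3) by (simp add: T.m_assoc)
  finally have t: "?t \<otimes>\<^bsub>T\<^esub> inv\<^bsub>T\<^esub> t = inv\<^bsub>T\<^esub> (tau j) \<otimes>\<^bsub>T\<^esub> tau i" .
  have "inv\<^bsub>F\<^esub> rel i = (- (frag_of i + frag_of (partner q i)), tau i)"
    using rel_closed[OF assms(1)] unfolding rel_def by (subst inv_gt_free) auto
  then have "rel j \<otimes>\<^bsub>F\<^esub> inv\<^bsub>F\<^esub> rel i = (frag_of (partner q j) - frag_of (partner q i) - (frag_of i - frag_of j),
      ?t \<otimes>\<^bsub>T\<^esub> inv\<^bsub>T\<^esub> t)"
    unfolding t rel_def by simp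
  then show ?thesis
    using rel_diff_in_relations[OF assms(2,1)] assms partner_less[of i q s] partner_less[of j q s]
    by (subst unit_degree_eq_iff) auto
qed

end

section \<open>The grading on the matrix algebra\<close>

lemma (in module) submodule_by_closure:
  assumes "H \<subseteq> carrier M" "\<zero>\<^bsub>M\<^esub> \<in> H"
    and "\<And>a b. a \<in> H \<Longrightarrow> b \<in> H \<Longrightarrow> a \<oplus>\<^bsub>M\<^esub> b \<in> H"
    and "\<And>a x. a \<in> carrier R \<Longrightarrow> x \<in> H \<Longrightarrow> a \<odot>\<^bsub>M\<^esub> x \<in> H"
  shows "submodule H R M"
proof (rule submoduleI)
  fix a assume "a \<in> H"
  then show "\<ominus>\<^bsub>M\<^esub> a \<in> H"
    using smult_l_minus[of \<one> a] assms(1) assms(4)[of "\<ominus>\<one>" a] by auto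
qed (use assms in auto)

locale graded_division_data =
  assoc_algebra scale + degree_group T q s ts + D: graded_algebra T "type_algebra scale" \<Gamma>
  for scale :: "'f::field \<Rightarrow> 'd::ring_1 \<Rightarrow> 'd"
    and T :: "'t monoid" and q s ts and \<Gamma> :: "'t \<Rightarrow> 'd set" +
  assumes homogeneous_units: "nonzero_homogeneous T (type_algebra scale) \<Gamma> \<subseteq> Units (type_algebra scale)"
begin

abbreviation "MA \<equiv> mat_algebra scale k"
abbreviation "GT \<equiv> G_tilde T q s ts"
abbreviation "MG \<equiv> M_grading scale T \<Gamma> q s ts"

sublocale MA: ring MA
  by (rule ring_mat_algebra)

sublocale MM: module scalar_ring MA
  by (rule module_mat_algebra)

sublocale GT: comm_group GT
  by (rule comm_group_G_tilde)

text \<open>The entries allowed at position \<open>(i, j)\<close> in a homogeneous matrix of degree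
  \<open>g\<close>. Zero is listed separately because \<open>g\<close> may not be the degree of any
  unit at that position.\<close>

definition entry_component :: "nat \<Rightarrow> nat \<Rightarrow> ((nat \<Rightarrow>\<^sub>0 int) \<times> 't) set \<Rightarrow> 'd set" where
  "entry_component i j g = {d. d = 0 \<or> (\<exists>t\<in>carrier T. udeg i j t = g \<and> d \<in> \<Gamma> t)}"

text \<open>The projection belonging to \<open>entry_component\<close>; by
  \<open>unit_degree_inj\<close> at most one \<open>t\<close> qualifies, so the \<open>THE\<close>
  is well defined for indices below \<open>k\<close>.\<close>

definition entry_part :: "nat \<Rightarrow> nat \<Rightarrow> ((nat \<Rightarrow>\<^sub>0 int) \<times> 't) set \<Rightarrow> 'd \<Rightarrow> 'd" where
  "entry_part i j g d = (if \<exists>t\<in>carrier T. udeg i j t = g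
     then D.hpart (THE t. t \<in> carrier T \<and> udeg i j t = g) d else 0)"

lemma entry_component_unit_degree:
  assumes "i < k" "j < k" "t \<in> carrier T"
  shows "entry_component i j (udeg i j t) = \<Gamma> t"
  using unit_degree_inj[OF assms(1,2)] assms(3) D.component_zero[OF assms(3)]
  by (auto simp: entry_component_def)

lemma entry_component_cases:
  assumes "i < k" "j < k"
  obtains t where "t \<in> carrier T" "udeg i j t = g" "entry_component i j g = \<Gamma> t"
  | "g \<notin> udeg i j ` carrier T" "entry_component i j g = {0}"
  using entry_component_unit_degree[OF assms] by (cases "g \<in> udeg i j ` carrier T")
    (auto simp: entry_component_def)

lemma entry_component_zero: "0 \<in> entry_component i j g"
  by (simp add: entry_component_def)

lemma entry_component_add:
  assumes "i < k" "j < k" "x \<in> entry_component i j g" "y \<in> entry_component i j g"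
  shows "x + y \<in> entry_component i j g"
  using D.component_add[of _ x y] assms(3,4) by (rule_tac entry_component_cases[OF assms(1,2), of g]) auto

lemma entry_component_scale:
  assumes "i < k" "j < k" "x \<in> entry_component i j g"
  shows "scale c x \<in> entry_component i j g"
  using D.component_smult[of _ x c] assms(3) by (rule_tac entry_component_cases[OF assms(1,2), of g]) auto

lemma entry_component_sum:
  assumes "i < k" "j < k" "\<And>l. l \<in> I \<Longrightarrow> f l \<in> entry_component i j g"
  shows "sum f I \<in> entry_component i j g"
  using assms(3)
proof (induction I rule: infinite_finite_induct)
  case (insert l I)
  then show ?case
    using entry_component_add[OF assms(1,2)] by simp
qed (simp_all add: entry_component_zero)

lemma entry_component_mult:
  assumes "i < k" "j < k" "l < k" "x \<in> entry_component i j g" "y \<in> entry_component j l h"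
  shows "x * y \<in> entry_component i l (g \<otimes>\<^bsub>GT\<^esub> h)"
proof (cases "x = 0 \<or> y = 0")
  case False
  then obtain t t' where "t \<in> carrier T" "udeg i j t = g" "x \<in> \<Gamma> t"
    "t' \<in> carrier T" "udeg j l t' = h" "y \<in> \<Gamma> t'"
    using assms(4,5) by (auto simp: entry_component_def)
  then show ?thesis
    using unit_degree_mult[OF assms(1-3), of t t'] D.component_mult[of t t' x y]
    unfolding entry_component_def by (auto intro!: bexI[of _ "t \<otimes>\<^bsub>T\<^esub> t'"])
qed (auto simp: entry_component_zero)

lemma entry_part_unit_degree:
  assumes "i < k" "j < k" "t \<in> carrier T"
  shows "entry_part i j (udeg i j t) d = D.hpart t d"
proof -
  have "(THE t'. t' \<in> carrier T \<and> udeg i j t' = udeg i j t) = t"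
    using unit_degree_inj[OF assms(1,2) _ assms(3)] assms(3) by (intro the_equality conjI) simp_all
  then show ?thesis
    using assms(3) unfolding entry_part_def by auto
qed

lemma entry_part_outside: "g \<notin> udeg i j ` carrier T \<Longrightarrow> entry_part i j g d = 0"
  by (auto simp: entry_part_def)

lemma entry_part_in:
  assumes "i < k" "j < k"
  shows "entry_part i j g d \<in> entry_component i j g"
  using entry_part_unit_degree[OF assms] entry_component_unit_degree[OF assms] D.hpart_in[of d]
    entry_part_outside[of g i j d] entry_component_zero
  by (cases "g \<in> udeg i j ` carrier T") auto

lemma entry_part_add:
  assumes "i < k" "j < k"
  shows "entry_part i j g (d + d') = entry_part i j g d + entry_part i j g d'"
  using entry_part_unit_degree[OF assms] D.hpart_add[of d d'] entry_part_outside[of g i j]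
  by (cases "g \<in> udeg i j ` carrier T") auto

lemma entry_part_component:
  assumes "i < k" "j < k" "d \<in> entry_component i j h"
  shows "entry_part i j g d = (if g = h then d else 0)"
proof (cases "d = 0 \<or> g \<notin> udeg i j ` carrier T")
  case True
  then show ?thesis
  proof
    assume "d = 0"
    then show ?thesis
      using entry_part_add[OF assms(1,2), of g 0 0] by simp
  next
    assume "g \<notin> udeg i j ` carrier T"
    then show ?thesis
      using assms(3) entry_part_outside[of g i j d] by (auto simp: entry_component_def)
  qed
next
  case False
  then obtain t t' where t: "t \<in> carrier T" "udeg i j t = g" and t': "t' \<in> carrier T" "udeg i j t' = h" "d \<in> \<Gamma> t'"
    using assms(3) by (auto simp: entry_component_def)
  then have "t = t' \<longleftrightarrow> g = h"
    using unit_degree_inj[OF assms(1,2) t(1) t'(1)] by auto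
  then show ?thesis
    using entry_part_unit_degree[OF assms(1,2) t(1), of d] D.hpart_homogeneous[OF t'(3,1) t(1)] t(2) by simp
qed

definition entrywise :: "((nat \<Rightarrow>\<^sub>0 int) \<times> 't) set \<Rightarrow> 'd mat set" where
  "entrywise g = {X \<in> carrier_mat k k. \<forall>i<k. \<forall>j<k. X $$ (i, j) \<in> entry_component i j g}"

lemma submodule_entrywise: "submodule (entrywise g) scalar_ring MA"
  by (rule MM.submodule_by_closure)
    (auto simp: entrywise_def entry_component_zero entry_component_add entry_component_scale)

text \<open>Replaces the linear span by a condition on entries. The entrywise set is a submodule
  containing the generators, and each of its matrices is a sum of matrix units that are zero or
  generators.\<close>

lemma M_grading_eq: "MG g = {X \<in> carrier_mat k k. \<forall>i<k. \<forall>j<k. X $$ (i, j) \<in> entry_component i j g}"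
  unfolding entrywise_def[symmetric] M_grading_def
proof (rule hull_unique)
  show "{unit_mat k i j d |i j t d. i < k \<and> j < k \<and> t \<in> carrier T \<and> d \<in> \<Gamma> t \<and> udeg i j t = g} \<subseteq> entrywise g"
    by (auto simp: entrywise_def entry_component_def)
  show "submodule (entrywise g) scalar_ring MA"
    by (rule submodule_entrywise)
  fix S
  assume gens: "{unit_mat k i j d |i j t d. i < k \<and> j < k \<and> t \<in> carrier T \<and> d \<in> \<Gamma> t \<and> udeg i j t = g} \<subseteq> S"
    and S: "submodule S scalar_ring MA"
  have zero: "0\<^sub>m k k \<in> S"
    using subgroup.one_closed[OF submodule.axioms(1)[OF S]] by simp
  show "entrywise g \<subseteq> S"
  proof
    fix X assume X: "X \<in> entrywise g"
    have el: "unit_mat k (fst p) (snd p) (X $$ p) \<in> S" if p: "p \<in> {..<k} \<times> {..<k}" for p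
    proof -
      obtain i j where ij: "p = (i, j)" "i < k" "j < k"
        using p by auto
      show ?thesis
      proof (cases "X $$ (i, j) = 0")
        case True
        then show ?thesis
          using zero unit_mat_eq_zero_iff[OF ij(2,3), of "0::'d"] ij(1) by simp
      next
        case False
        then obtain t where "t \<in> carrier T" "udeg i j t = g" "X $$ (i, j) \<in> \<Gamma> t"
          using X ij by (force simp: entrywise_def entry_component_def)
        then have "unit_mat k i j (X $$ (i, j)) \<in> S"
          using gens ij(2,3) by blast
        then show ?thesis
          using ij(1) by simp
      qed
    qed
    have "finsum MA (\<lambda>p. unit_mat k (fst p) (snd p) (X $$ p)) I \<in> S" if "I \<subseteq> {..<k} \<times> {..<k}" for I
      using that
    proof (induction I rule: infinite_finite_induct)
      case (insert p I)
      then have "unit_mat k (fst p) (snd p) (X $$ p) \<oplus>\<^bsub>MA\<^esub> finsum MA (\<lambda>p. unit_mat k (fst p) (snd p) (X $$ p)) I \<in> S"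
        using MM.submoduleE(5)[OF S] el by blast
      then show ?case
        using insert by (subst MA.finsum_insert) auto
    qed (use zero in \<open>auto simp: MA.finsum_infinite\<close>)
    then have "(\<Oplus>\<^bsub>MA\<^esub>p\<in>{..<k} \<times> {..<k}. unit_mat k (fst p) (snd p) (X $$ p)) \<in> S"
      by blast
    moreover have "(\<Oplus>\<^bsub>MA\<^esub>p\<in>{..<k} \<times> {..<k}. unit_mat k (fst p) (snd p) (X $$ p)) = X"
      using X by (intro mat_decompose[symmetric]) (simp add: entrywise_def)
    ultimately show "X \<in> S"
      by (simp only:)
  qed
qed

text \<open>The projection onto degree \<open>g\<close> acts entrywise. At a fixed position
  different \<open>t\<close> give different degrees, so the decomposition of a matrix reduces to the
  decompositions of its entries in \<open>D\<close>.\<close>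

lemma M_grading_group_grading: "group_grading GT MA MG"
proof (rule group_gradingI[where P = "\<lambda>g X. mat k k (\<lambda>(i, j). entry_part i j g (X $$ (i, j)))"])
  let ?P = "\<lambda>g X. mat k k (\<lambda>(i, j). entry_part i j g (X $$ (i, j)))"
  show "comm_group GT"
    by (rule comm_group_G_tilde)
  show "abelian_group MA"
    by (rule MA.is_abelian_group)
  show "submodule (MG g) scalar_ring MA" for g
    using submodule_entrywise[of g] by (simp add: M_grading_eq entrywise_def)
  show "X \<otimes>\<^bsub>MA\<^esub> Y \<in> MG (g \<otimes>\<^bsub>GT\<^esub> h)" if X: "X \<in> MG g" and Y: "Y \<in> MG h" for g h X Y
  proof -
    have c: "X \<in> carrier_mat k k" "Y \<in> carrier_mat k k"
      using X Y by (auto simp: M_grading_eq)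
    have "(X * Y) $$ (i, j) \<in> entry_component i j (g \<otimes>\<^bsub>GT\<^esub> h)" if ij: "i < k" "j < k" for i j
      unfolding mult_mat_index[OF c ij]
    proof (rule entry_component_sum[OF ij])
      fix l assume "l \<in> {..<k}"
      then show "X $$ (i, l) * Y $$ (l, j) \<in> entry_component i j (g \<otimes>\<^bsub>GT\<^esub> h)"
        using X Y ij by (intro entry_component_mult[of i l j]) (auto simp: M_grading_eq)
    qed
    then show ?thesis
      using c mult_carrier_mat[OF c] by (simp add: M_grading_eq)
  qed
  show "?P g X \<in> MG g" for g X
    by (auto simp: M_grading_eq entry_part_in)
  show "?P g (X \<oplus>\<^bsub>MA\<^esub> Y) = ?P g X \<oplus>\<^bsub>MA\<^esub> ?P g Y" if "X \<in> carrier MA" "Y \<in> carrier MA" for g X Y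
    by (rule mat_eqI[of _ k]) (use that in \<open>auto simp: entry_part_add\<close>)
  show "?P g X = (if g = h then X else \<zero>\<^bsub>MA\<^esub>)" if X: "X \<in> MG h" for g h X
  proof (rule mat_eqI[of _ k])
    fix a b assume ab: "a < k" "b < k"
    then have "entry_part a b g (X $$ (a, b)) = (if g = h then X $$ (a, b) else 0)"
      using X by (intro entry_part_component) (auto simp: M_grading_eq)
    then show "?P g X $$ (a, b) = (if g = h then X else \<zero>\<^bsub>MA\<^esub>) $$ (a, b)"
      using ab by simp
  qed (use X in \<open>auto simp: M_grading_eq\<close>)
  have part_nonzero: "g \<in> udeg i j ` D.hsupp d" if ij: "i < k" "j < k" and nz: "entry_part i j g d \<noteq> 0" for g i j d
  proof -
    obtain t where t: "t \<in> carrier T" "g = udeg i j t"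
      using nz entry_part_outside[of g i j d] by blast
    then have "t \<in> D.hsupp d"
      using nz t entry_part_unit_degree[OF ij t(1)] by (simp add: D.hsupp_def)
    then show ?thesis
      using t(2) by blast
  qed
  fix X assume "X \<in> carrier MA"
  then have X: "X \<in> carrier_mat k k"
    by simp
  let ?S = "{g \<in> carrier GT. ?P g X \<noteq> \<zero>\<^bsub>MA\<^esub>}"
  have "?S \<subseteq> (\<Union>i<k. \<Union>j<k. udeg i j ` D.hsupp (X $$ (i, j)))"
  proof
    fix g assume "g \<in> ?S"
    then have "?P g X \<noteq> 0\<^sub>m k k"
      by simp
    then obtain i j where ij: "i < k" "j < k" "entry_part i j g (X $$ (i, j)) \<noteq> 0"
      using mat_eqI[of "?P g X" k "0\<^sub>m k k"] by auto
    then have "g \<in> udeg i j ` D.hsupp (X $$ (i, j))"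
      by (rule part_nonzero)
    then show "g \<in> (\<Union>i<k. \<Union>j<k. udeg i j ` D.hsupp (X $$ (i, j)))"
      using ij(1,2) by (intro UN_I[of i] UN_I[of j]) auto
  qed
  then show fin: "finite ?S"
    by (rule finite_subset) (auto intro!: D.finite_hsupp)
  show "(\<Oplus>\<^bsub>MA\<^esub>g\<in>?S. ?P g X) = X"
  proof (rule mat_eqI[OF _ X])
    show "(\<Oplus>\<^bsub>MA\<^esub>g\<in>?S. ?P g X) \<in> carrier_mat k k"
      by (rule finsum_mat_algebra_closed) auto
    fix i j assume ij: "i < k" "j < k"
    let ?d = "X $$ (i, j)"
    have fd: "finite (D.hsupp ?d)" "D.hsupp ?d \<subseteq> carrier T"
      using D.finite_hsupp[of ?d] by (auto simp: D.hsupp_def)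
    have sub: "udeg i j ` D.hsupp ?d \<subseteq> ?S"
    proof
      fix g assume "g \<in> udeg i j ` D.hsupp ?d"
      then obtain t where t: "t \<in> carrier T" "D.hpart t ?d \<noteq> 0" "g = udeg i j t"
        by (auto simp: D.hsupp_def)
      then have "?P g X $$ (i, j) \<noteq> 0"
        using ij entry_part_unit_degree[OF ij t(1)] by simp
      then have "?P g X \<noteq> 0\<^sub>m k k"
        using ij by (metis index_zero_mat(1))
      then show "g \<in> ?S"
        using t unit_degree_closed[OF ij t(1)] by simp
    qed
    have "(\<Oplus>\<^bsub>MA\<^esub>g\<in>?S. ?P g X) $$ (i, j) = (\<Sum>g\<in>?S. ?P g X $$ (i, j))"
      by (rule finsum_mat_algebra_index) (use ij in auto)
    also have "\<dots> = (\<Sum>g\<in>?S. entry_part i j g ?d)"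
      using ij by (intro sum.cong) auto
    \<comment> \<open>At this position only degrees coming from homogeneous components of the entry
      contribute; the sum is then reindexed by their degrees in \<open>T\<close>.\<close>
    also have "\<dots> = (\<Sum>g\<in>udeg i j ` D.hsupp ?d. entry_part i j g ?d)"
      using part_nonzero[OF ij] by (intro sum.mono_neutral_right[OF fin sub]) blast
    also have "\<dots> = (\<Sum>t\<in>D.hsupp ?d. entry_part i j (udeg i j t) ?d)"
      using unit_degree_inj[OF ij] fd(2) by (subst sum.reindex) (auto intro!: inj_onI)
    also have "\<dots> = (\<Sum>t\<in>D.hsupp ?d. D.hpart t ?d)"
      using fd(2) entry_part_unit_degree[OF ij] by (intro sum.cong) auto
    also have "\<dots> = ?d"
      using D.hpart_sum[of ?d] by (simp add: finsum_type_algebra)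
    finally show "(\<Oplus>\<^bsub>MA\<^esub>g\<in>?S. ?P g X) $$ (i, j) = ?d" .
  qed
qed

end

section \<open>The involution on the matrix algebra\<close>

lemma diag_block_mat_replicate:
  assumes "B \<in> carrier_mat 2 2"
  shows "diag_block_mat (replicate s B) \<in> carrier_mat (2 * s) (2 * s)"
    and "a < 2 * s \<Longrightarrow> b < 2 * s \<Longrightarrow> diag_block_mat (replicate s B) $$ (a, b)
      = (if a div 2 = b div 2 then B $$ (a mod 2, b mod 2) else 0)"
proof (induction s arbitrary: a b)
  case (Suc s)
  let ?M = "diag_block_mat (replicate s B)"
  have dims: "dim_row B = 2" "dim_col B = 2" "dim_row ?M = 2 * s" "dim_col ?M = 2 * s"
    using assms Suc.IH(1) by auto
  {
    case 1
    show ?case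
      by (rule carrier_matI) (use dims in \<open>simp_all add: Let_def\<close>)
  next
    case 2
    have "diag_block_mat (replicate (Suc s) B) $$ (a, b) = (if a < 2 then if b < 2 then B $$ (a, b) else 0
        else if b < 2 then 0 else ?M $$ (a - 2, b - 2))"
      using 2 dims by (simp add: Let_def)
    moreover have "?M $$ (a - 2, b - 2) = (if (a - 2) div 2 = (b - 2) div 2
        then B $$ ((a - 2) mod 2, (b - 2) mod 2) else 0)" if "\<not> a < 2" "\<not> b < 2"
      using that 2 by (intro Suc.IH(2)) auto
    ultimately show ?case
      by (simp add: le_div_geq le_mod_geq)
  }
qed auto

lemma diag_block_mat_entries:
  assumes "diag_block_mat Bs \<in> carrier_mat m m"
  shows "diag_block_mat (map (\<lambda>d. mat_of_rows_list 1 [[d]]) ds @ Bs)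
      \<in> carrier_mat (length ds + m) (length ds + m)"
    and "a < length ds + m \<Longrightarrow> b < length ds + m \<Longrightarrow>
      diag_block_mat (map (\<lambda>d. mat_of_rows_list 1 [[d]]) ds @ Bs) $$ (a, b)
        = (if a < length ds then if a = b then ds ! a else 0
           else if b < length ds then 0 else diag_block_mat Bs $$ (a - length ds, b - length ds))"
proof (induction ds arbitrary: a b)
  case Nil
  {
    case 1
    then show ?case
      using assms by simp
  next
    case 2
    then show ?case
      by simp
  }
next
  case (Cons d ds)
  let ?M = "diag_block_mat (map (\<lambda>d. mat_of_rows_list 1 [[d]]) ds @ Bs)"
  have dims: "dim_row ?M = length ds + m" "dim_col ?M = length ds + m"
    using Cons.IH(1) by auto
  {
    case 1
    show ?case
      by (rule carrier_matI) (use dims in \<open>simp_all add: Let_def mat_of_rows_list_def\<close>)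
  next
    case 2
    have IH: "a' < length ds + m \<Longrightarrow> b' < length ds + m \<Longrightarrow> ?M $$ (a', b')
        = (if a' < length ds then if a' = b' then ds ! a' else 0
           else if b' < length ds then 0 else diag_block_mat Bs $$ (a' - length ds, b' - length ds))" for a' b'
      by (rule Cons.IH(2))
    have "diag_block_mat (map (\<lambda>d. mat_of_rows_list 1 [[d]]) (d # ds) @ Bs) $$ (a, b)
        = (if a = 0 then if b = 0 then d else 0 else if b = 0 then 0 else ?M $$ (a - 1, b - 1))"
      using 2 dims by (simp add: Let_def mat_of_rows_list_def)
    then show ?case
      using 2 IH[of "a - 1" "b - 1"] by (cases a; cases b) auto
  }
qed

lemma partner_eq_partner [simp]: "partner q a = partner q b \<longleftrightarrow> a = b"
  by (metis partner_partner)

context graded_division_data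
begin

text \<open>An inverse supplied by \<open>Units\<close> is not known to be homogeneous. However, its
  component in degree \<open>t\<close> inverted is already a right inverse of \<open>d\<close>,
  hence equals the whole inverse.\<close>

lemma homogeneous_inverse:
  assumes "t \<in> carrier T" "d \<in> \<Gamma> t" "d \<noteq> 0"
  obtains y where "d * y = 1" "y * d = 1" "y \<in> \<Gamma> (inv\<^bsub>T\<^esub> t)"
proof -
  have "d \<in> Units (type_algebra scale)"
    using homogeneous_units assms by (auto simp: nonzero_homogeneous_def)
  then obtain y where y: "d * y = 1" "y * d = 1"
    by (auto simp: Units_def)
  let ?y = "D.hpart (inv\<^bsub>T\<^esub> t) y"
  have "d * ?y = D.hpart (t \<otimes>\<^bsub>T\<^esub> inv\<^bsub>T\<^esub> t) (d * y)"
    using D.hpart_mult_left[OF assms(2), of y "inv\<^bsub>T\<^esub> t"] assms(1) by simp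
  also have "\<dots> = 1"
    using D.hpart_homogeneous[OF D.one_in_component] assms(1) y by simp
  finally have "y * (d * ?y) = y"
    by simp
  then have "?y = y"
    using y by (simp add: mult.assoc[symmetric])
  then show thesis
    using that y D.hpart_in[of y "inv\<^bsub>T\<^esub> t"] assms(1) by simp
qed

end

locale involution_data = graded_division_data scale T q s ts \<Gamma>
  for scale :: "'f::field \<Rightarrow> 'd::ring_1 \<Rightarrow> 'd"
    and T :: "'t monoid" and q s ts and \<Gamma> :: "'t \<Rightarrow> 'd set" +
  fixes \<phi>\<^sub>0 :: "'d \<Rightarrow> 'd" and \<delta> :: 'f and ds :: "'d list"
  assumes involution_D: "involution_grading T (type_algebra scale) \<phi>\<^sub>0 \<Gamma>"
    and sign: "\<delta> \<in> {1, -1}"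
    and length_ds: "length ds = q"
    and ds_in: "i < q \<Longrightarrow> ds ! i \<in> \<Gamma> (ts ! i)"
    and ds_nonzero: "i < q \<Longrightarrow> ds ! i \<noteq> 0"
    and ds_sym: "i < q \<Longrightarrow> \<phi>\<^sub>0 (ds ! i) = scale \<delta> (ds ! i)"
begin

lemma phi0_add: "\<phi>\<^sub>0 (x + y) = \<phi>\<^sub>0 x + \<phi>\<^sub>0 y"
  and phi0_scale: "\<phi>\<^sub>0 (scale c x) = scale c (\<phi>\<^sub>0 x)"
  and phi0_mult: "\<phi>\<^sub>0 (x * y) = \<phi>\<^sub>0 y * \<phi>\<^sub>0 x"
  and phi0_phi0 [simp]: "\<phi>\<^sub>0 (\<phi>\<^sub>0 x) = x"
  using involution_D unfolding involution_grading_def algebra_involution_def by auto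

lemma phi0_in: "t \<in> carrier T \<Longrightarrow> x \<in> \<Gamma> t \<Longrightarrow> \<phi>\<^sub>0 x \<in> \<Gamma> t"
  using involution_D unfolding involution_grading_def by blast

lemma phi0_zero [simp]: "\<phi>\<^sub>0 0 = 0"
  using phi0_add[of 0 0] by simp

lemma phi0_one [simp]: "\<phi>\<^sub>0 1 = 1"
  using phi0_mult[of "\<phi>\<^sub>0 1" 1] by simp

lemma phi0_sum: "\<phi>\<^sub>0 (sum f I) = (\<Sum>i\<in>I. \<phi>\<^sub>0 (f i))"
  by (induction I rule: infinite_finite_induct) (simp_all add: phi0_add)

lemma sign_sign [simp]: "\<delta> * \<delta> = 1"
  using sign by auto

text \<open>The only nonzero entry of \<Phi> in row \<open>i\<close>; it stands in column
  \<open>partner q i\<close>.\<close>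

definition p :: "nat \<Rightarrow> 'd" where
  "p i = (if i < q then ds ! i else if even (i - q) then 1 else scale \<delta> 1)"

definition pinv :: "nat \<Rightarrow> 'd" where
  "pinv i = (SOME y. p i * y = 1 \<and> y * p i = 1)"

lemma p_in: "i < k \<Longrightarrow> p i \<in> \<Gamma> (tau i)"
  using ds_in D.one_in_component D.component_smult[OF _ D.one_in_component, of \<delta>]
  by (auto simp: p_def tau_def)

lemma p_nonzero: "i < k \<Longrightarrow> p i \<noteq> 0"
  using ds_nonzero sign by (auto simp: p_def)

lemma pinv:
  assumes "i < k"
  shows p_pinv [simp]: "p i * pinv i = 1"
    and pinv_p [simp]: "pinv i * p i = 1"
    and pinv_in: "pinv i \<in> \<Gamma> (inv\<^bsub>T\<^esub> (tau i))"
proof -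
  obtain y where y: "p i * y = 1" "y * p i = 1" "y \<in> \<Gamma> (inv\<^bsub>T\<^esub> (tau i))"
    using homogeneous_inverse[OF tau_closed p_in p_nonzero] assms by blast
  then have *: "p i * pinv i = 1 \<and> pinv i * p i = 1"
    unfolding pinv_def by (intro someI[of "\<lambda>y. p i * y = 1 \<and> y * p i = 1"]) blast
  then show "p i * pinv i = 1" "pinv i * p i = 1"
    by auto
  have "pinv i = y * (p i * pinv i)"
    using y by (simp add: mult.assoc[symmetric])
  then show "pinv i \<in> \<Gamma> (inv\<^bsub>T\<^esub> (tau i))"
    using * y(3) by simp
qed

text \<open>Says that \<Phi> is \<delta>-hermitian: transposing and applying
  \<open>\<phi>\<^sub>0\<close> multiplies it by \<delta>. For the blocks this rests on the square
  of \<delta> being 1.\<close>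

lemma phi0_p:
  assumes "i < k"
  shows "\<phi>\<^sub>0 (p i) = scale \<delta> (p (partner q i))"
  using ds_sym by (cases rule: partner_cases[of i q]) (auto simp: p_def phi0_scale)

lemma phi0_pinv:
  assumes i: "i < k"
  shows "\<phi>\<^sub>0 (pinv i) = scale \<delta> (pinv (partner q i))"
proof -
  have i': "partner q i < k"
    using partner_less[OF i] .
  have "\<phi>\<^sub>0 (pinv i) * scale \<delta> (p (partner q i)) = 1"
    using phi0_mult[of "p i" "pinv i"] phi0_p[OF i] i by simp
  then have "\<phi>\<^sub>0 (pinv i) * scale \<delta> (p (partner q i)) * scale \<delta> (pinv (partner q i))
      = scale \<delta> (pinv (partner q i))"
    by simp
  then show ?thesis
    using i' by (simp add: scale_mult_left scale_mult_right mult.assoc)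
qed

section \<open>An entry formula for the involution\<close>

abbreviation "Phi \<equiv> Phi_mat scale s ds \<delta>"
abbreviation "MI \<equiv> M_involution scale \<phi>\<^sub>0 q s ds \<delta>"

text \<open>\<Phi> is monomial with underlying permutation \<open>partner\<close>: diagonal in the
  first \<open>q\<close> rows, and exchanging the two members of each pair.\<close>

lemma Phi_closed: "Phi \<in> carrier_mat k k"
  and Phi_index: "a < k \<Longrightarrow> b < k \<Longrightarrow> Phi $$ (a, b) = (if a = partner q b then p a else 0)"
proof -
  let ?B = "mat_of_rows_list 2 [[0, 1], [scale \<delta> 1, 0]]"
  have B: "?B \<in> carrier_mat 2 2"
    by (auto simp: mat_of_rows_list_def)
  note rep = diag_block_mat_replicate[OF B]
  note ent = diag_block_mat_entries[OF rep(1)[of s], where ds = ds, unfolded length_ds]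
  show "Phi \<in> carrier_mat k k"
    unfolding Phi_mat_def using ent(1) .
  assume ab: "a < k" "b < k"
  show "Phi $$ (a, b) = (if a = partner q b then p a else 0)"
  proof (cases "a < q \<or> b < q")
    case True
    then show ?thesis
      unfolding Phi_mat_def ent(2)[OF ab] using partner_less_iff[of q b] by (auto simp: p_def)
  next
    case False
    have eq: "Phi $$ (a, b) = (if (a - q) div 2 = (b - q) div 2 then ?B $$ ((a - q) mod 2, (b - q) mod 2) else 0)"
      unfolding Phi_mat_def ent(2)[OF ab] using False ab rep(2)[of "a - q" s "b - q"] by auto
    have B_ent: "?B $$ (0, 0) = 0" "?B $$ (0, Suc 0) = 1" "?B $$ (Suc 0, 0) = scale \<delta> 1" "?B $$ (Suc 0, Suc 0) = 0"
      by (auto simp: mat_of_rows_list_def)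
    have parity: "2 * m \<noteq> Suc (2 * n)" "Suc (2 * n) \<noteq> 2 * m" for m n :: nat
      by presburger+
    obtain i where i: "a = q + 2 * i \<or> a = Suc (q + 2 * i)"
      using False partner_cases[of a q] by metis
    obtain j where j: "b = q + 2 * j \<or> b = Suc (q + 2 * j)"
      using False partner_cases[of b q] by metis
    have "Suc (q + 2 * n) - q = Suc (2 * n)" for n
      by simp
    then show ?thesis
      using i j unfolding eq by (elim disjE) (simp_all add: p_def B_ent parity)
  qed
qed

text \<open>The inverse of a monomial matrix is monomial for the inverse permutation, which here is
  \<open>partner\<close> again.\<close>

lemma inv_Phi: "inv\<^bsub>MA\<^esub> Phi = mat k k (\<lambda>(a, b). if b = partner q a then pinv b else 0)" (is "_ = ?Q")
proof -
  have Q: "?Q \<in> carrier_mat k k"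
    by simp
  have "Phi * ?Q = 1\<^sub>m k"
  proof (rule mat_eqI[OF mult_carrier_mat[OF Phi_closed Q]])
    fix a b assume ab: "a < k" "b < k"
    have "(Phi * ?Q) $$ (a, b) = (\<Sum>l<k. if l = partner q a then (if a = b then 1 else 0) else 0)"
      unfolding mult_mat_index[OF Phi_closed Q ab] using ab
      by (intro sum.cong) (auto simp: Phi_index)
    then show "(Phi * ?Q) $$ (a, b) = 1\<^sub>m k $$ (a, b)"
      using ab partner_less[OF ab(1)] by simp
  qed simp
  moreover have "?Q * Phi = 1\<^sub>m k"
  proof (rule mat_eqI[OF mult_carrier_mat[OF Q Phi_closed]])
    fix a b assume ab: "a < k" "b < k"
    have "(?Q * Phi) $$ (a, b) = (\<Sum>l<k. if l = partner q a then (if a = b then 1 else 0) else 0)"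
      unfolding mult_mat_index[OF Q Phi_closed ab] using ab partner_less[OF ab(1)] partner_less[OF ab(2)]
      by (intro sum.cong) (auto simp: Phi_index)
    then show "(?Q * Phi) $$ (a, b) = 1\<^sub>m k $$ (a, b)"
      using ab partner_less[OF ab(1)] by simp
  qed simp
  ultimately have "?Q = inv\<^bsub>MA\<^esub> Phi"
    using Phi_closed by (intro MA.inv_unique') simp_all
  then show ?thesis ..
qed

lemma MI_closed: "X \<in> carrier_mat k k \<Longrightarrow> MI X \<in> carrier_mat k k"
  unfolding M_involution_def inv_Phi
  by (intro mult_carrier_mat[OF mult_carrier_mat Phi_closed, of _ _ k]) auto

text \<open>As \<Phi> and its inverse are monomial, only one term of each product survives. The
  involution therefore moves an entry at \<open>(i, j)\<close> to the position of the partners of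
  \<open>j\<close> and \<open>i\<close>, up to invertible factors.\<close>

lemma MI_index:
  assumes X: "X \<in> carrier_mat k k" and ab: "a < k" "b < k"
  shows "MI X $$ (a, b) = pinv (partner q a) * \<phi>\<^sub>0 (X $$ (partner q b, partner q a)) * p (partner q b)"
proof -
  let ?Q = "mat k k (\<lambda>(a, b). if b = partner q a then pinv b else 0)"
  let ?Y = "map_mat \<phi>\<^sub>0 (transpose_mat X)"
  have Q: "?Q \<in> carrier_mat k k" and Y: "?Y \<in> carrier_mat k k"
    using X by auto
  have QY: "(?Q * ?Y) $$ (a, c) = pinv (partner q a) * ?Y $$ (partner q a, c)" if "c < k" for c
  proof -
    have "(?Q * ?Y) $$ (a, c) = (\<Sum>l<k. if l = partner q a then pinv l * ?Y $$ (l, c) else 0)"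
      unfolding mult_mat_index[OF Q Y ab(1) that] using ab(1) that by (intro sum.cong) auto
    then show ?thesis
      using partner_less[OF ab(1)] by simp
  qed
  have "MI X $$ (a, b) = (\<Sum>l<k. (?Q * ?Y) $$ (a, l) * Phi $$ (l, b))"
    unfolding M_involution_def inv_Phi
    by (rule mult_mat_index[OF mult_carrier_mat[OF Q Y] Phi_closed ab])
  also have "\<dots> = (\<Sum>l<k. if l = partner q b then pinv (partner q a) * ?Y $$ (partner q a, l) * p l else 0)"
    using ab(2) QY Phi_index by (intro sum.cong) auto
  also have "\<dots> = pinv (partner q a) * ?Y $$ (partner q a, partner q b) * p (partner q b)"
    using partner_less[OF ab(2)] by simp
  also have "?Y $$ (partner q a, partner q b) = \<phi>\<^sub>0 (X $$ (partner q b, partner q a))"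
    using X partner_less[OF ab(1)] partner_less[OF ab(2)] by auto
  finally show ?thesis .
qed

lemma bij_partner: "bij_betw (partner q) {..<k} {..<k}"
  by (rule bij_betw_byWitness[where f' = "partner q"]) (auto simp: partner_less)

text \<open>\<open>\<phi>\<^sub>0\<close> reverses products in \<open>D\<close> just as
  transposition reverses matrix products, and between the two factors \<open>p\<close> and
  \<open>pinv\<close> of the same index cancel. Summing over \<open>l\<close> or over its partner
  makes no difference.\<close>

lemma MI_mult:
  assumes X: "X \<in> carrier_mat k k" and Y: "Y \<in> carrier_mat k k"
  shows "MI (X * Y) = MI Y * MI X"
proof (rule mat_eqI[OF MI_closed[OF mult_carrier_mat[OF X Y]] mult_carrier_mat[OF MI_closed[OF Y] MI_closed[OF X]]])
  fix a b assume ab: "a < k" "b < k"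
  let ?a = "partner q a" and ?b = "partner q b"
  note ab' = partner_less[OF ab(1)] partner_less[OF ab(2)]
  let ?f = "\<lambda>l. pinv ?a * \<phi>\<^sub>0 (Y $$ (l, ?a)) * (\<phi>\<^sub>0 (X $$ (?b, l)) * p ?b)"
  have "(MI Y * MI X) $$ (a, b) = (\<Sum>l<k. MI Y $$ (a, l) * MI X $$ (l, b))"
    by (rule mult_mat_index[OF MI_closed[OF Y] MI_closed[OF X] ab])
  also have "\<dots> = (\<Sum>l<k. ?f (partner q l))"
  proof (rule sum.cong)
    fix l assume "l \<in> {..<k}"
    then have l: "l < k" "partner q l < k"
      using partner_less by auto
    have "MI Y $$ (a, l) * MI X $$ (l, b) = pinv ?a * \<phi>\<^sub>0 (Y $$ (partner q l, ?a)) *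
        (p (partner q l) * pinv (partner q l)) * (\<phi>\<^sub>0 (X $$ (?b, partner q l)) * p ?b)"
      unfolding MI_index[OF Y ab(1) l(1)] MI_index[OF X l(1) ab(2)] by (simp only: mult.assoc)
    then show "MI Y $$ (a, l) * MI X $$ (l, b) = ?f (partner q l)"
      using l(2) by simp
  qed simp
  also have "\<dots> = (\<Sum>l<k. ?f l)"
    by (rule sum.reindex_bij_betw[OF bij_partner])
  also have "\<dots> = pinv ?a * \<phi>\<^sub>0 ((X * Y) $$ (?b, ?a)) * p ?b"
    unfolding mult_mat_index[OF X Y ab'(2,1)] phi0_sum phi0_mult sum_distrib_left sum_distrib_right
    by (simp add: mult.assoc)
  also have "\<dots> = MI (X * Y) $$ (a, b)"
    by (rule MI_index[OF mult_carrier_mat[OF X Y] ab, symmetric])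
  finally show "MI (X * Y) $$ (a, b) = (MI Y * MI X) $$ (a, b)" ..
qed

text \<open>Applying the formula twice produces one sign \<delta> from \<open>p\<close> and one from
  \<open>pinv\<close>, and they cancel.\<close>

lemma MI_MI:
  assumes X: "X \<in> carrier_mat k k"
  shows "MI (MI X) = X"
proof (rule mat_eqI[OF MI_closed[OF MI_closed[OF X]] X])
  fix a b assume ab: "a < k" "b < k"
  let ?a = "partner q a" and ?b = "partner q b"
  note ab' = partner_less[OF ab(1)] partner_less[OF ab(2)]
  have "MI (MI X) $$ (a, b) = pinv ?a * \<phi>\<^sub>0 (pinv b * \<phi>\<^sub>0 (X $$ (a, b)) * p a) * p ?b"
    unfolding MI_index[OF MI_closed[OF X] ab] MI_index[OF X ab'(2,1)] by simp
  also have "\<dots> = pinv ?a * (scale \<delta> (p ?a) * (X $$ (a, b) * scale \<delta> (pinv ?b))) * p ?b"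
    using phi0_p[OF ab(1)] phi0_pinv[OF ab(2)] by (simp add: phi0_mult)
  also have "\<dots> = (pinv ?a * p ?a) * X $$ (a, b) * (pinv ?b * p ?b)"
    by (simp add: scale_mult_left scale_mult_right mult.assoc)
  finally show "MI (MI X) $$ (a, b) = X $$ (a, b)"
    using ab' by simp
qed

text \<open>The factors \<open>pinv\<close> and \<open>p\<close> shift the degree in
  \<open>T\<close> by exactly the correction that appears in
  \<open>unit_degree_partner\<close>.\<close>

lemma MI_in_M_grading:
  assumes "X \<in> MG g"
  shows "MI X \<in> MG g"
proof -
  have X: "X \<in> carrier_mat k k" and Xe: "\<And>a b. a < k \<Longrightarrow> b < k \<Longrightarrow> X $$ (a, b) \<in> entry_component a b g"
    using assms by (auto simp: M_grading_eq)
  have "MI X $$ (a, b) \<in> entry_component a b g" if ab: "a < k" "b < k" for a b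
  proof -
    let ?a = "partner q a" and ?b = "partner q b"
    note ab' = partner_less[OF ab(1)] partner_less[OF ab(2)]
    show ?thesis
    proof (cases "X $$ (?b, ?a) = 0")
      case True
      then show ?thesis
        by (simp add: MI_index[OF X ab] entry_component_zero)
    next
      case False
      then obtain t where t: "t \<in> carrier T" "udeg ?b ?a t = g" "X $$ (?b, ?a) \<in> \<Gamma> t"
        using Xe[OF ab'(2,1)] by (auto simp: entry_component_def)
      let ?t = "inv\<^bsub>T\<^esub> (tau ?a) \<otimes>\<^bsub>T\<^esub> t \<otimes>\<^bsub>T\<^esub> tau ?b"
      have "pinv ?a * \<phi>\<^sub>0 (X $$ (?b, ?a)) \<in> \<Gamma> (inv\<^bsub>T\<^esub> (tau ?a) \<otimes>\<^bsub>T\<^esub> t)"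
        using D.component_mult[OF _ t(1) pinv_in[OF ab'(1)] phi0_in[OF t(1,3)]] by simp
      then have "MI X $$ (a, b) \<in> \<Gamma> ?t"
        unfolding MI_index[OF X ab]
        using D.component_mult[OF _ _ _ p_in[OF ab'(2)]] t(1) by simp
      moreover have "udeg a b ?t = g"
        using unit_degree_partner[OF ab'(2,1) t(1)] t(2) by simp
      ultimately show ?thesis
        using t(1) unfolding entry_component_def by (auto intro!: bexI[of _ ?t])
    qed
  qed
  then show ?thesis
    using MI_closed[OF X] by (simp add: M_grading_eq)
qed

lemma M_involution_grading: "involution_grading GT MA MI MG"
proof -
  have "MI (X + Y) = MI X + MI Y" if X: "X \<in> carrier_mat k k" and Y: "Y \<in> carrier_mat k k" for X Y
  proof (rule mat_eqI[OF MI_closed add_carrier_mat])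
    fix a b assume ab: "a < k" "b < k"
    have "(MI X + MI Y) $$ (a, b) = MI X $$ (a, b) + MI Y $$ (a, b)"
      using ab MI_closed[OF Y] by simp
    then show "MI (X + Y) $$ (a, b) = (MI X + MI Y) $$ (a, b)"
      unfolding MI_index[OF X ab] MI_index[OF Y ab] MI_index[OF add_carrier_mat[OF Y] ab]
      using X Y partner_less[OF ab(1)] partner_less[OF ab(2)]
      by (simp add: phi0_add distrib_left distrib_right)
  qed (use X Y MI_closed[OF Y] in simp_all)
  moreover have "MI (map_mat (scale c) X) = map_mat (scale c) (MI X)" if X: "X \<in> carrier_mat k k" for c X
  proof (rule mat_eqI[OF MI_closed])
    fix a b assume ab: "a < k" "b < k"
    have "map_mat (scale c) X \<in> carrier_mat k k" "map_mat (scale c) (MI X) $$ (a, b) = scale c (MI X $$ (a, b))"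
      using ab X MI_closed[OF X] by simp_all
    then show "MI (map_mat (scale c) X) $$ (a, b) = map_mat (scale c) (MI X) $$ (a, b)"
      using MI_index[OF X ab] MI_index[OF _ ab, of "map_mat (scale c) X"] X
        partner_less[OF ab(1)] partner_less[OF ab(2)]
      by (simp add: phi0_scale scale_mult_left scale_mult_right)
  qed (use X MI_closed[OF X] in simp_all)
  ultimately have "algebra_involution MA MI"
    unfolding algebra_involution_def mat_algebra_simps
    using MI_closed MI_mult MI_MI by (intro conjI ballI allI funcsetI)
  then show ?thesis
    using M_grading_group_grading MI_in_M_grading unfolding involution_grading_def by blast
qed

end

section \<open>Reduction to gradings by groups of natural numbers\<close>

text \<open>Every element of the generated subgroup is the value of a finite word in the generators
  and their inverses, and there are countably many such words.\<close>

lemma (in group) countable_generate: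
  assumes "countable S" "S \<subseteq> carrier G"
  shows "countable (generate G S)"
proof -
  let ?L = "lists (S \<union> m_inv G ` S)"
  let ?w = "\<lambda>ws. foldr (\<otimes>) ws \<one>"
  have closed: "?w ws \<in> carrier G" if "ws \<in> ?L" for ws
    using that assms(2) by (induction ws) auto
  have append: "?w (us @ vs) = ?w us \<otimes> ?w vs" if "us \<in> ?L" "vs \<in> ?L" for us vs
    using that(1)
  proof (induction us)
    case (Cons u us)
    then have "u \<in> carrier G" "?w us \<in> carrier G" "?w vs \<in> carrier G"
      using assms(2) closed that(2) by auto
    then show ?case
      using Cons by (simp add: m_assoc)
  qed (use closed that(2) in simp)
  have "generate G S \<subseteq> ?w ` ?L"
  proof
    fix x assume "x \<in> generate G S"
    then show "x \<in> ?w ` ?L"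
    proof induction
      case one
      show ?case
        by (rule image_eqI[of _ _ "[]"]) auto
    next
      case (incl h)
      then show ?case
        using assms(2) by (intro image_eqI[of _ _ "[h]"]) auto
    next
      case (inv h)
      then show ?case
        using assms(2) by (intro image_eqI[of _ _ "[inv h]"]) auto
    next
      case (eng h1 h2)
      then obtain us vs where "us \<in> ?L" "vs \<in> ?L" "h1 = ?w us" "h2 = ?w vs"
        by blast
      then show ?case
        using append by (intro image_eqI[of _ _ "us @ vs"]) auto
    qed
  qed
  moreover have "countable (?w ` ?L)"
    using assms(1) by (intro countable_image countable_lists) auto
  ultimately show ?thesis
    by (rule countable_subset)
qed

context graded_algebra
begin

lemma hsupp_subset_support: "a \<in> carrier A \<Longrightarrow> hsupp a \<subseteq> grading_support G A \<Gamma>"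
  using hpart_in by (auto simp: hsupp_def grading_support_def)

text \<open>The subgroup generated by the support is countable, so its elements can be renamed as
  natural numbers. All components outside it vanish, so nothing is lost.\<close>

lemma regrading_by_nat:
  assumes "countable (grading_support G A \<Gamma>)"
  obtains N :: "nat monoid" and f where
    "group_grading N A (\<lambda>n. \<Gamma> (f n))" "f ` carrier N \<subseteq> carrier G"
    "grading_support G A \<Gamma> \<subseteq> f ` carrier N"
proof -
  let ?S = "grading_support G A \<Gamma>"
  define H where "H = generate G ?S"
  have S: "?S \<subseteq> carrier G"
    by (auto simp: grading_support_def)
  have cH: "countable H"
    unfolding H_def by (rule G.countable_generate[OF assms S])
  have sub: "subgroup H G"
    unfolding H_def by (rule G.generate_is_subgroup[OF S])
  note HG = subgroup.mem_carrier[OF sub]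
  \<comment> \<open>\<open>e\<close> numbers the elements of the subgroup and \<open>f\<close>
    decodes the numbers; the operation of \<open>N\<close> is the one transported along
    \<open>e\<close>.\<close>
  define e where "e = to_nat_on H"
  define f where "f = the_inv_into H e"
  have inj: "inj_on e H"
    unfolding e_def using cH by (rule inj_on_to_nat_on)
  have fe [simp]: "f (e h) = h" if "h \<in> H" for h
    unfolding f_def using inj that by (rule the_inv_into_f_f)
  define N where "N = \<lparr>carrier = e ` H, monoid.mult = (\<lambda>m n. e (f m \<otimes>\<^bsub>G\<^esub> f n)), one = e \<one>\<^bsub>G\<^esub>\<rparr>"
  have N [simp]: "carrier N = e ` H" "m \<otimes>\<^bsub>N\<^esub> n = e (f m \<otimes>\<^bsub>G\<^esub> f n)" "\<one>\<^bsub>N\<^esub> = e \<one>\<^bsub>G\<^esub>" for m n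
    by (simp_all add: N_def)
  have "comm_group N"
  proof (rule comm_groupI)
    fix x assume "x \<in> carrier N"
    then obtain h where h: "h \<in> H" "x = e h"
      by auto
    then show "\<exists>y\<in>carrier N. y \<otimes>\<^bsub>N\<^esub> x = \<one>\<^bsub>N\<^esub>"
      using subgroup.m_inv_closed[OF sub h(1)] HG[OF h(1)] by (intro bexI[of _ "e (inv\<^bsub>G\<^esub> h)"]) auto
  qed (use subgroup.m_closed[OF sub] subgroup.one_closed[OF sub] HG in
      \<open>auto simp: G.m_ac\<close>)
  have fN: "f n \<in> carrier G" if "n \<in> carrier N" for n
    using that HG by auto
  have supp_H: "hsupp a \<subseteq> H" if "a \<in> carrier A" for a
    using hsupp_subset_support[OF that] generate.incl[of _ ?S G] unfolding H_def by blast
  have supp_N: "{n \<in> carrier N. hpart (f n) a \<noteq> \<zero>\<^bsub>A\<^esub>} = e ` hsupp a" if a: "a \<in> carrier A" for a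
    using supp_H[OF a] HG by (auto simp: hsupp_def)
  have "group_grading N A (\<lambda>n. \<Gamma> (f n))"
  proof (rule group_gradingI[where P = "\<lambda>n. hpart (f n)"])
    show "comm_group N"
      by fact
    show "abelian_group A"
      by (rule A.is_abelian_group)
    show "x \<otimes>\<^bsub>A\<^esub> y \<in> \<Gamma> (f (g \<otimes>\<^bsub>N\<^esub> h))"
      if "g \<in> carrier N" "h \<in> carrier N" "x \<in> \<Gamma> (f g)" "y \<in> \<Gamma> (f h)" for g h x y
      using component_mult[OF fN[OF that(1)] fN[OF that(2)] that(3,4)] that(1,2)
        subgroup.m_closed[OF sub] by auto
    show "hpart (f g) x = (if g = h then x else \<zero>\<^bsub>A\<^esub>)"
      if "g \<in> carrier N" "h \<in> carrier N" "x \<in> \<Gamma> (f h)" for g h x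
      using hpart_homogeneous[OF that(3) fN[OF that(2)] fN[OF that(1)]] that(1,2) by auto
    show "finite {n \<in> carrier N. hpart (f n) a \<noteq> \<zero>\<^bsub>A\<^esub>}" if "a \<in> carrier A" for a
      unfolding supp_N[OF that] using finite_hsupp[OF that] by simp
    show "(\<Oplus>\<^bsub>A\<^esub>n\<in>{n \<in> carrier N. hpart (f n) a \<noteq> \<zero>\<^bsub>A\<^esub>}. hpart (f n) a) = a" if a: "a \<in> carrier A" for a
    proof -
      have c: "hpart g a \<in> carrier A" "f (e g) = g" if "g \<in> hsupp a" for g
        using hpart_closed[OF a, of g] that supp_H[OF a] by (auto simp: hsupp_def)
      have "(\<Oplus>\<^bsub>A\<^esub>n\<in>e ` hsupp a. hpart (f n) a) = (\<Oplus>\<^bsub>A\<^esub>g\<in>hsupp a. hpart (f (e g)) a)"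
        using c inj_on_subset[OF inj supp_H[OF a]] by (intro A.finsum_reindex) auto
      also have "\<dots> = (\<Oplus>\<^bsub>A\<^esub>g\<in>hsupp a. hpart g a)"
        using c by (intro A.finsum_cong') auto
      finally show ?thesis
        unfolding supp_N[OF a] using hpart_sum[OF a] by simp
    qed
  qed (use fN component_submodule hpart_in hpart_add in auto)
  moreover have "grading_support G A \<Gamma> \<subseteq> f ` carrier N"
  proof
    fix g assume "g \<in> ?S"
    then have "g \<in> H"
      unfolding H_def by (rule generate.incl)
    then show "g \<in> f ` carrier N"
      by (intro image_eqI[of _ _ "e g"]) auto
  qed
  ultimately show thesis
    using that fN by blast
qed

text \<open>Frees fineness from the type \<open>nat\<close>: a competing grading by a group of any
  type is regraded by natural numbers. The component witnessing properness is nonzero, so it lies in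
  the support and survives.\<close>

lemma fine_no_proper_refinement:
  assumes fine: "fine_grading TYPE(nat) T A \<Gamma>\<^sub>0" and "countable (grading_support G A \<Gamma>)"
  shows "\<not> proper_refinement G \<Gamma> T \<Gamma>\<^sub>0 A"
proof
  assume proper: "proper_refinement G \<Gamma> T \<Gamma>\<^sub>0 A"
  obtain N :: "nat monoid" and f where N: "group_grading N A (\<lambda>n. \<Gamma> (f n))"
    "f ` carrier N \<subseteq> carrier G" "grading_support G A \<Gamma> \<subseteq> f ` carrier N"
    using regrading_by_nat[OF assms(2)] .
  obtain g t where g: "g \<in> carrier G" "\<Gamma> g \<noteq> {\<zero>\<^bsub>A\<^esub>}" "t \<in> carrier T" "\<Gamma> g \<subset> \<Gamma>\<^sub>0 t"
    using proper unfolding proper_refinement_def by blast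
  then obtain n where "n \<in> carrier N" "f n = g"
    using N(3) unfolding grading_support_def by blast
  then have "proper_refinement N (\<lambda>n. \<Gamma> (f n)) T \<Gamma>\<^sub>0 A"
    using proper N(2) g unfolding proper_refinement_def refinement_def by blast
  then show False
    using fine N(1) unfolding fine_grading_def by blast
qed

end

text \<open>Each component projection is linear, so it vanishes as soon as it kills a basis. Only
  the finitely many degrees occurring in basis vectors can escape this.\<close>

lemma finite_grading_support:
  assumes "graded_algebra G (type_algebra scale) \<Gamma>" "finite_dimensional_vector_space scale B"
  shows "finite (grading_support G (type_algebra scale) \<Gamma>)"
proof -
  interpret graded_algebra G "type_algebra scale" \<Gamma>
    by fact
  interpret V: finite_dimensional_vector_space scale B
    by fact
  let ?S = "\<Union>b\<in>B. hsupp b"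
  have span: "hpart g x = 0" if g: "g \<in> carrier G - ?S" for g x
  proof -
    have "x \<in> V.span B"
      using V.span_Basis by simp
    then show ?thesis
    proof (induction rule: V.span_induct_alt)
      case base
      show ?case
        using hpart_zero g by simp
    next
      case (step c b y)
      then have "hpart g b = 0"
        using g by (auto simp: hsupp_def)
      then have "hpart g (scale c b) = 0"
        using hpart_smult[of b g c] g by simp
      then show ?case
        using hpart_add[of "scale c b" y g] g step by simp
    qed
  qed
  have "grading_support G (type_algebra scale) \<Gamma> \<subseteq> ?S"
  proof
    fix g assume "g \<in> grading_support G (type_algebra scale) \<Gamma>"
    then obtain x where x: "g \<in> carrier G" "x \<in> \<Gamma> g" "x \<noteq> 0"
      using component_zero[of g] by (auto simp: grading_support_def)
    then have "hpart g x = x"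
      using hpart_homogeneous[OF x(2,1,1)] by simp
    then show "g \<in> ?S"
      using span[of g x] x by (cases "g \<in> ?S") auto
  qed
  then show ?thesis
    using V.finite_Basis finite_hsupp by (auto intro: finite_subset)
qed

section \<open>Refinements of the matrix grading\<close>

context graded_division_data
begin

sublocale Gr: graded_algebra GT MA MG
  by unfold_locales (rule M_grading_group_grading)

lemma homogeneous_mult_eq_zero:
  assumes "t \<in> carrier T" "d \<in> \<Gamma> t" "d \<noteq> 0"
  shows "d * x = 0 \<longleftrightarrow> x = 0" "x * d = 0 \<longleftrightarrow> x = 0"
proof -
  obtain y where y: "d * y = 1" "y * d = 1"
    using homogeneous_inverse[OF assms] by blast
  have "x = y * (d * x)" "x = (x * d) * y"
    using y by (simp_all add: mult.assoc[symmetric]) (simp_all add: mult.assoc)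
  then show "d * x = 0 \<longleftrightarrow> x = 0" "x * d = 0 \<longleftrightarrow> x = 0"
    by auto
qed

lemma unit_mat_in_M_grading:
  "i < k \<Longrightarrow> j < k \<Longrightarrow> t \<in> carrier T \<Longrightarrow> d \<in> \<Gamma> t \<Longrightarrow> unit_mat k i j d \<in> MG (udeg i j t)"
  by (auto simp: M_grading_eq entry_component_def)

lemma M_grading_entry:
  assumes "X \<in> MG g" "a < k" "b < k" "X $$ (a, b) \<noteq> 0"
  obtains t where "t \<in> carrier T" "udeg a b t = g" "X $$ (a, b) \<in> \<Gamma> t"
  using assms by (auto simp: M_grading_eq entry_component_def)

text \<open>For \<open>i \<noteq> l\<close> the diagonal alternative of
  \<open>unit_degree_cases\<close> is excluded, which leaves two positions.\<close>

lemma off_diagonal_support: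
  assumes "X \<in> MG (udeg i l t)" "i < k" "l < k" "i \<noteq> l" "t \<in> carrier T"
    and "a < k" "b < k" "X $$ (a, b) \<noteq> 0"
  shows "a = i \<and> b = l \<or> a = partner q l \<and> b = partner q i"
proof -
  obtain t' where "t' \<in> carrier T" "udeg a b t' = udeg i l t"
    using M_grading_entry[OF assms(1,6,7,8)] by blast
  then show ?thesis
    using assms(4) by (auto elim!: unit_degree_cases[OF assms(2,3,5,6,7), of t'])
qed

end

section \<open>Elements on the diagonal that are homogeneous for \<Delta>\<close>

locale refinement_data = involution_data scale T q s ts \<Gamma> \<phi>\<^sub>0 \<delta> ds + W: graded_algebra H "mat_algebra scale (q + 2 * s)" \<Delta>
  for scale :: "'f::field \<Rightarrow> 'd::ring_1 \<Rightarrow> 'd"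
    and T :: "'t monoid" and q s ts and \<Gamma> :: "'t \<Rightarrow> 'd set"
    and \<phi>\<^sub>0 :: "'d \<Rightarrow> 'd" and \<delta> :: 'f and ds :: "'d list"
    and H :: "'h monoid" and \<Delta> :: "'h \<Rightarrow> 'd mat set" +
  assumes Delta_involution: "h \<in> carrier H \<Longrightarrow> X \<in> \<Delta> h \<Longrightarrow> MI X \<in> \<Delta> h"
    and refines: "refinement H \<Delta> GT MG"
    and not_two_zero: "(q, s) \<noteq> (2, 0)"
    and full_support: "grading_support T (type_algebra scale) \<Gamma> = carrier T"
begin

abbreviation "U \<equiv> unit_mat k"

lemma Delta_closed: "h \<in> carrier H \<Longrightarrow> X \<in> \<Delta> h \<Longrightarrow> X \<in> carrier_mat k k"
  using W.component_closed by simp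

lemma Delta_mult: "h \<in> carrier H \<Longrightarrow> h' \<in> carrier H \<Longrightarrow> X \<in> \<Delta> h \<Longrightarrow> Y \<in> \<Delta> h' \<Longrightarrow> X * Y \<in> \<Delta> (h \<otimes>\<^bsub>H\<^esub> h')"
  using W.component_mult by simp

lemma Delta_in_M_grading:
  assumes "h \<in> carrier H"
  obtains g where "g \<in> carrier GT" "\<Delta> h \<subseteq> MG g"
  using refines assms unfolding refinement_def by blast

text \<open>If the component of degree \<open>h\<close> lay in \<open>MG g'\<close> with
  \<open>g'\<close> different from \<open>g\<close>, projecting \<open>X\<close> onto degree
  \<open>g'\<close> would give a decomposition of zero with respect to \<Delta> that contains this
  component, which must then vanish.\<close>

lemma hpart_in_M_grading:
  assumes X: "X \<in> MG g" and g: "g \<in> carrier GT" and h: "h \<in> carrier H"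
  shows "W.hpart h X \<in> MG g"
proof -
  obtain g' where g': "g' \<in> carrier GT" "\<Delta> h \<subseteq> MG g'"
    using Delta_in_M_grading[OF h] .
  have Xc: "X \<in> carrier MA"
    using Gr.component_closed[OF g X] .
  show ?thesis
  proof (cases "g' = g \<or> h \<notin> W.hsupp X")
    case True
    then show ?thesis
      using g' W.hpart_in[OF Xc h] Gr.component_zero[OF g] h by (auto simp: W.hsupp_def)
  next
    case False
    let ?S = "W.hsupp X"
    have S: "finite ?S" "?S \<subseteq> carrier H"
      using W.finite_hsupp[OF Xc] by (auto simp: W.hsupp_def)
    let ?f = "\<lambda>h. Gr.hpart g' (W.hpart h X)"
    \<comment> \<open>Each \<Delta>-component lies in a single \<open>MG g''\<close>, so the
      projection keeps or kills it. The projected terms thus remain in their \<Delta>-components and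
      \<open>hpart_unique\<close> applies.\<close>
    have f: "?f h' = W.hpart h' X \<or> ?f h' = \<zero>\<^bsub>MA\<^esub>" if "h' \<in> ?S" for h'
    proof -
      have h': "h' \<in> carrier H"
        using that S by blast
      obtain g'' where g'': "g'' \<in> carrier GT" "\<Delta> h' \<subseteq> MG g''"
        using Delta_in_M_grading[OF h'] .
      then have "W.hpart h' X \<in> MG g''"
        using W.hpart_in[OF Xc h'] by blast
      then show ?thesis
        using Gr.hpart_homogeneous[OF _ g''(1) g'(1)] by presburger
    qed
    have "\<zero>\<^bsub>MA\<^esub> = Gr.hpart g' X"
      using Gr.hpart_homogeneous[OF X g g'(1)] False by simp
    also have "\<dots> = Gr.hpart g' (finsum MA (\<lambda>h. W.hpart h X) ?S)"
      using W.hpart_sum[OF Xc] by simp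
    also have "\<dots> = finsum MA ?f ?S"
      using W.hpart_closed[OF Xc] S(2) g'(1) by (intro Gr.hpart_finsum) auto
    finally have "W.hpart h \<zero>\<^bsub>MA\<^esub> = (if h \<in> ?S then ?f h else \<zero>\<^bsub>MA\<^esub>)"
    proof (intro W.hpart_unique[OF S _ _ h])
      fix h' assume h': "h' \<in> ?S"
      then have "h' \<in> carrier H"
        using S(2) by blast
      then show "?f h' \<in> \<Delta> h'"
        using f[OF h'] W.hpart_in[OF Xc] W.component_zero by auto
    qed
    then have "?f h = \<zero>\<^bsub>MA\<^esub>"
      using False W.hpart_zero[OF h] by simp
    moreover have "?f h = W.hpart h X"
      using W.hpart_in[OF Xc h] g' Gr.hpart_homogeneous[of "W.hpart h X" g' g'] by auto
    ultimately show ?thesis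
      using False by (simp add: W.hsupp_def)
  qed
qed

text \<open>The \<Delta>-components of the unit at \<open>(i, l)\<close> have entries adding up to 1
  at that position, so one of these entries is nonzero.\<close>

lemma off_diagonal_element:
  assumes il: "i < k" "l < k" "i \<noteq> l"
  obtains h X where "h \<in> carrier H" "X \<in> \<Delta> h" "X \<in> MG (udeg i l \<one>\<^bsub>T\<^esub>)" "X $$ (i, l) \<noteq> 0"
proof -
  let ?g = "udeg i l \<one>\<^bsub>T\<^esub>"
  have g: "?g \<in> carrier GT"
    using unit_degree_closed il by simp
  have U: "U i l 1 \<in> MG ?g"
    using unit_mat_in_M_grading[OF il(1,2) T.one_closed] D.one_in_component by simp
  have Uc: "U i l 1 \<in> carrier MA"
    by simp
  have "1 = U i l (1 :: 'd) $$ (i, l)"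
    using il by simp
  also have "\<dots> = finsum MA (\<lambda>h. W.hpart h (U i l 1)) (W.hsupp (U i l 1)) $$ (i, l)"
    using W.hpart_sum[OF Uc] by simp
  also have "\<dots> = (\<Sum>h\<in>W.hsupp (U i l 1). W.hpart h (U i l 1) $$ (i, l))"
    using W.hpart_closed[OF Uc] il by (intro finsum_mat_algebra_index) (auto simp: W.hsupp_def)
  finally obtain h where h: "h \<in> W.hsupp (U i l 1)" "W.hpart h (U i l 1) $$ (i, l) \<noteq> 0"
    by (metis (no_types, lifting) sum.neutral zero_neq_one)
  then have "h \<in> carrier H"
    by (simp add: W.hsupp_def)
  then show thesis
    using that W.hpart_in[OF Uc] hpart_in_M_grading[OF U g] h(2) by blast
qed

text \<open>The required element is a product of elements with the degrees of the units at
  \<open>(i, l)\<close> and \<open>(l, i)\<close>. By \<open>off_diagonal_support\<close> each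
  factor occupies at most two positions, and their products fall on the diagonal.\<close>

lemma diagonal_element:
  assumes il: "i < k" "l < k" "i \<noteq> l"
  obtains h Y t where "h \<in> carrier H" "Y \<in> \<Delta> h" "t \<in> carrier T" "Y $$ (i, i) \<in> \<Gamma> t" "Y $$ (i, i) \<noteq> 0"
    "\<And>a b. a < k \<Longrightarrow> b < k \<Longrightarrow> Y $$ (a, b) \<noteq> 0 \<Longrightarrow> a = b \<and> (a = i \<or> a = partner q l)"
proof -
  obtain h X where h: "h \<in> carrier H" "X \<in> \<Delta> h" and X: "X \<in> MG (udeg i l \<one>\<^bsub>T\<^esub>)" "X $$ (i, l) \<noteq> 0"
    using off_diagonal_element[OF il] .
  obtain h' Z where h': "h' \<in> carrier H" "Z \<in> \<Delta> h'" and Z: "Z \<in> MG (udeg l i \<one>\<^bsub>T\<^esub>)" "Z $$ (l, i) \<noteq> 0"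
    using off_diagonal_element[OF il(2,1)] il(3) by metis
  obtain t where t: "t \<in> carrier T" "X $$ (i, l) \<in> \<Gamma> t"
    using M_grading_entry[OF X(1) il(1,2) X(2)] .
  obtain t' where t': "t' \<in> carrier T" "Z $$ (l, i) \<in> \<Gamma> t'"
    using M_grading_entry[OF Z(1) il(2,1) Z(2)] .
  have Xc: "X \<in> carrier_mat k k" and Zc: "Z \<in> carrier_mat k k"
    using Delta_closed h h' by auto
  note Xs = off_diagonal_support[OF X(1) il T.one_closed]
  note Zs = off_diagonal_support[OF Z(1) il(2,1) il(3)[symmetric] T.one_closed]
  \<comment> \<open>Row \<open>i\<close> of \<open>X\<close> has only the entry in column
    \<open>l\<close>: the second possible position is in row \<open>i\<close> only if
    \<open>i\<close> is the partner of \<open>l\<close>, and then it coincides with the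
    first.\<close>
  have "(X * Z) $$ (i, i) = (\<Sum>c<k. if c = l then X $$ (i, l) * Z $$ (l, i) else 0)"
    unfolding mult_mat_index[OF Xc Zc il(1,1)]
  proof (intro sum.cong refl)
    fix c assume "c \<in> {..<k}"
    then have *: "X $$ (i, c) \<noteq> 0 \<Longrightarrow> c = l"
      using Xs[OF il(1), of c] partner_partner[of q l] by auto
    show "X $$ (i, c) * Z $$ (c, i) = (if c = l then X $$ (i, l) * Z $$ (l, i) else 0)"
    proof (cases "c = l")
      case False
      then have "X $$ (i, c) = 0"
        using * by blast
      then show ?thesis
        using False by simp
    qed simp
  qed
  then have ii: "(X * Z) $$ (i, i) = X $$ (i, l) * Z $$ (l, i)"
    using il by simp
  show thesis
  proof (rule that[of "h \<otimes>\<^bsub>H\<^esub> h'" "X * Z" "t \<otimes>\<^bsub>T\<^esub> t'"])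
    show "h \<otimes>\<^bsub>H\<^esub> h' \<in> carrier H" "X * Z \<in> \<Delta> (h \<otimes>\<^bsub>H\<^esub> h')" "t \<otimes>\<^bsub>T\<^esub> t' \<in> carrier T"
      using h h' t t' Delta_mult by auto
    show "(X * Z) $$ (i, i) \<in> \<Gamma> (t \<otimes>\<^bsub>T\<^esub> t')"
      unfolding ii using D.component_mult[OF t(1) t'(1) t(2) t'(2)] by simp
    show "(X * Z) $$ (i, i) \<noteq> 0"
      unfolding ii using homogeneous_mult_eq_zero(1)[OF t X(2)] Z(2) by simp
    fix a b assume ab: "a < k" "b < k" "(X * Z) $$ (a, b) \<noteq> 0"
    then obtain c where "c < k" "X $$ (a, c) \<noteq> 0" "Z $$ (c, b) \<noteq> 0"
      unfolding mult_mat_index[OF Xc Zc ab(1,2)]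
      by (metis (no_types, lifting) lessThan_iff mult_zero_left mult_zero_right sum.neutral)
    then show "a = b \<and> (a = i \<or> a = partner q l)"
      using Xs[OF ab(1), of c] Zs[of c, OF _ ab(2)] il by auto
  qed
qed

text \<open>For \<open>i < q\<close> two different auxiliary indices \<open>l\<close> and \<open>l'\<close> are needed to separate \<open>i\<close> from its companions;
  they exist unless \<open>(q, s) = (2, 0)\<close> or the matrices have size 1.\<close>

lemma homogeneous_diagonal_unit:
  assumes i: "i < k"
  obtains h t d where "h \<in> carrier H" "t \<in> carrier T" "d \<in> \<Gamma> t" "d \<noteq> 0" "U i i d \<in> \<Delta> h"
proof -
  note result = that
  have single: thesis if h: "h \<in> carrier H" "Y \<in> \<Delta> h" and t: "t \<in> carrier T" "Y $$ (i, i) \<in> \<Gamma> t" "Y $$ (i, i) \<noteq> 0"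
    and supp: "\<And>a b. a < k \<Longrightarrow> b < k \<Longrightarrow> Y $$ (a, b) \<noteq> 0 \<Longrightarrow> a = i \<and> b = i" for h Y t
  proof -
    have "Y = U i i (Y $$ (i, i))"
    proof (rule mat_eqI[OF Delta_closed[OF h] unit_mat_closed])
      fix a b assume ab: "a < k" "b < k"
      show "Y $$ (a, b) = U i i (Y $$ (i, i)) $$ (a, b)"
        unfolding unit_mat_index[OF ab] using supp[OF ab] by (cases "Y $$ (a, b) = 0") auto
    qed
    then show thesis
      using result[OF h(1) t] h(2) by simp
  qed
  consider "k = 1" | "partner q i \<noteq> i" | "partner q i = i" "k \<noteq> 1"
    by blast
  then show thesis
  proof cases
    case 1
    have "1\<^sub>m k \<in> \<Delta> \<one>\<^bsub>H\<^esub>"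
      using W.one_in_component by simp
    then show thesis
      using 1 i D.one_in_component by (intro single[of "\<one>\<^bsub>H\<^esub>" "1\<^sub>m k" "\<one>\<^bsub>T\<^esub>"]) auto
  next
    case 2
    \<comment> \<open>For \<open>l = partner q i\<close> the two admissible diagonal positions are
      both \<open>i\<close>, so one product suffices.\<close>
    obtain h Y t where Y: "h \<in> carrier H" "Y \<in> \<Delta> h" "t \<in> carrier T" "Y $$ (i, i) \<in> \<Gamma> t" "Y $$ (i, i) \<noteq> 0"
      "\<And>a b. a < k \<Longrightarrow> b < k \<Longrightarrow> Y $$ (a, b) \<noteq> 0 \<Longrightarrow> a = b \<and> (a = i \<or> a = partner q (partner q i))"
      using diagonal_element[OF i partner_less[OF i] 2[symmetric]] by blast
    show thesis
      by (rule single[OF Y(1-5)]) (use Y(6) in auto)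
  next
    case 3
    have "i < q"
      using 3 partner_eq_iff by blast
    \<comment> \<open>Since \<open>q > 0\<close>, a positive \<open>s\<close> gives this at once;
      for \<open>s = 0\<close> the sizes 1 and 2 are excluded by the case and by
      \<open>not_two_zero\<close>.\<close>
    then have "k \<ge> 3"
      using 3(2) not_two_zero i by (cases s) auto
    \<comment> \<open>The two smallest indices other than \<open>i\<close>. Their partners differ,
      so the supports of the two diagonal elements meet only in \<open>i\<close>.\<close>
    define l l' :: nat where "l = (if i = 0 then 1 else 0)" and "l' = (if i < 2 then 2 else 1)"
    then have l: "l < k" "l \<noteq> i" "l' < k" "l' \<noteq> i" "l \<noteq> l'"
      using \<open>k \<ge> 3\<close> by auto
    obtain h Y t where Y: "h \<in> carrier H" "Y \<in> \<Delta> h" "t \<in> carrier T" "Y $$ (i, i) \<in> \<Gamma> t" "Y $$ (i, i) \<noteq> 0"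
      "\<And>a b. a < k \<Longrightarrow> b < k \<Longrightarrow> Y $$ (a, b) \<noteq> 0 \<Longrightarrow> a = b \<and> (a = i \<or> a = partner q l)"
      using diagonal_element[OF i l(1) l(2)[symmetric]] by blast
    obtain h' Z t' where Z: "h' \<in> carrier H" "Z \<in> \<Delta> h'" "t' \<in> carrier T" "Z $$ (i, i) \<in> \<Gamma> t'" "Z $$ (i, i) \<noteq> 0"
      "\<And>a b. a < k \<Longrightarrow> b < k \<Longrightarrow> Z $$ (a, b) \<noteq> 0 \<Longrightarrow> a = b \<and> (a = i \<or> a = partner q l')"
      using diagonal_element[OF i l(3) l(4)[symmetric]] by blast
    have YZ: "(Y * Z) $$ (a, b) = (if a = b then Y $$ (a, a) * Z $$ (a, a) else 0)" if ab: "a < k" "b < k" for a b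
    proof -
      have "(Y * Z) $$ (a, b) = (\<Sum>c<k. if c = a then (if a = b then Y $$ (a, a) * Z $$ (a, a) else 0) else 0)"
        unfolding mult_mat_index[OF Delta_closed[OF Y(1,2)] Delta_closed[OF Z(1,2)] ab]
      proof (intro sum.cong refl)
        fix c assume "c \<in> {..<k}"
        then have "c \<noteq> a \<Longrightarrow> Y $$ (a, c) = 0" "c \<noteq> b \<Longrightarrow> Z $$ (c, b) = 0"
          using Y(6)[of a c] Z(6)[of c b] ab by auto
        then show "Y $$ (a, c) * Z $$ (c, b) = (if c = a then (if a = b then Y $$ (a, a) * Z $$ (a, a) else 0) else 0)"
          by (cases "c = a"; cases "c = b") auto
      qed
      then show ?thesis
        using ab by simp
    qed
    show thesis
    proof (rule single)
      show "h \<otimes>\<^bsub>H\<^esub> h' \<in> carrier H" "Y * Z \<in> \<Delta> (h \<otimes>\<^bsub>H\<^esub> h')" "t \<otimes>\<^bsub>T\<^esub> t' \<in> carrier T"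
        using Y Z Delta_mult by auto
      show "(Y * Z) $$ (i, i) \<in> \<Gamma> (t \<otimes>\<^bsub>T\<^esub> t')"
        using YZ[OF i i] D.component_mult[OF Y(3) Z(3) Y(4) Z(4)] by simp
      show "(Y * Z) $$ (i, i) \<noteq> 0"
        using YZ[OF i i] homogeneous_mult_eq_zero(1)[OF Y(3-5)] Z(5) by simp
      fix a b assume ab: "a < k" "b < k" "(Y * Z) $$ (a, b) \<noteq> 0"
      then have "a = b" "Y $$ (a, a) \<noteq> 0" "Z $$ (a, a) \<noteq> 0"
        using YZ[OF ab(1,2)] by (auto split: if_splits)
      then show "a = i \<and> b = i"
        using Y(6)[OF ab(1,1)] Z(6)[OF ab(1,1)] l(5) by auto
    qed
  qed
qed

end

section \<open>Diagonal idempotents and the gradings of the corners\<close>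

context refinement_data
begin

text \<open>Let \<open>Y\<close> be the component of the idempotent in trivial degree. Multiplying
  by a homogeneous \<open>U j j d\<close> turns \<open>Y\<close> into a component of a matrix that
  is \<open>U j j d\<close> or zero, hence into that matrix. Cancelling the invertible
  \<open>d\<close> determines column \<open>j\<close> of \<open>Y\<close>.\<close>

lemma unit_in_Delta_one:
  assumes i: "i < k"
  shows "U i i 1 \<in> \<Delta> \<one>\<^bsub>H\<^esub>"
proof -
  let ?Y = "W.hpart \<one>\<^bsub>H\<^esub> (U i i 1)"
  have Uc: "U i i (1 :: 'd) \<in> carrier MA"
    by simp
  have Y: "?Y \<in> \<Delta> \<one>\<^bsub>H\<^esub>"
    using W.hpart_in[OF Uc] by simp
  then have Yc: "?Y \<in> carrier_mat k k"
    using Delta_closed by blast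
  have "?Y = U i i 1"
  proof (rule mat_eqI[OF Yc unit_mat_closed])
    fix a j assume aj: "a < k" "j < k"
    obtain h t d where h: "h \<in> carrier H" and d: "t \<in> carrier T" "d \<in> \<Gamma> t" "d \<noteq> 0" and z: "U j j d \<in> \<Delta> h"
      using homogeneous_diagonal_unit[OF aj(2)] .
    have "?Y * U j j d = W.hpart (\<one>\<^bsub>H\<^esub> \<otimes>\<^bsub>H\<^esub> h) (U i i 1 * U j j d)"
      using W.hpart_mult_right[OF z Uc W.G.one_closed h] by simp
    also have "\<dots> = (if i = j then U j j d else 0\<^sub>m k k)"
      using W.hpart_homogeneous[OF z h h] W.hpart_zero[OF h] h i aj(2)
      by (simp add: unit_mat_mult_unit_mat)
    finally have "(?Y * U j j d) $$ (a, j) = (if i = j then U j j d else 0\<^sub>m k k) $$ (a, j)"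
      by simp
    then have "?Y $$ (a, j) * d = (if i = j \<and> a = j then d else 0)"
      using mult_unit_mat_index[OF Yc aj(2) aj, of j d] aj by (simp split: if_splits)
    then have "(?Y $$ (a, j) - (if i = j \<and> a = j then 1 else 0)) * d = 0"
      by (simp add: left_diff_distrib split: if_splits)
    then have "?Y $$ (a, j) = (if i = j \<and> a = j then 1 else 0)"
      unfolding homogeneous_mult_eq_zero(2)[OF d] by simp
    then show "?Y $$ (a, j) = U i i 1 $$ (a, j)"
      using aj by auto
  qed
  then show ?thesis
    using Y by simp
qed

lemma unit_mat_corner:
  fixes X :: "'d mat"
  assumes "X \<in> carrier_mat k k" "i < k" "j < k"
  shows "U i i 1 * X * U j j 1 = U i j (X $$ (i, j))"
proof -
  have UX: "U i i 1 * X \<in> carrier_mat k k"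
    using mult_carrier_mat[OF unit_mat_closed assms(1)] .
  show ?thesis
  proof (rule mat_eqI[OF mult_carrier_mat[OF UX unit_mat_closed] unit_mat_closed])
    fix a b assume ab: "a < k" "b < k"
    show "(U i i 1 * X * U j j 1) $$ (a, b) = U i j (X $$ (i, j)) $$ (a, b)"
      unfolding mult_unit_mat_index[OF UX assms(3) ab] unit_mat_mult_index[OF assms(1,2) ab(1) assms(3)]
        unit_mat_index[OF ab] by simp
  qed
qed

text \<open>The diagonal idempotents have trivial degree, so taking \<Delta>-components commutes
  with multiplying by them on both sides, and a component of a matrix unit stays at its
  position.\<close>

lemma hpart_unit_mat:
  assumes h: "h \<in> carrier H" and ij: "i < k" "j < k"
  shows "W.hpart h (U i j d) = U i j (W.hpart h (U i j d) $$ (i, j))"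
proof -
  have Uc: "U i j d \<in> carrier MA" "U i i 1 * U i j d \<in> carrier MA"
    using mult_carrier_mat[OF unit_mat_closed unit_mat_closed] by auto
  have hc: "W.hpart h (U i j d) \<in> carrier_mat k k"
    using W.hpart_closed[OF Uc(1) h] by simp
  have "U i j d = U i i 1 * U i j d * U j j 1"
    using ij by (simp add: unit_mat_mult_unit_mat)
  then have "W.hpart h (U i j d) = W.hpart (h \<otimes>\<^bsub>H\<^esub> \<one>\<^bsub>H\<^esub>) ((U i i 1 * U i j d) * U j j 1)"
    using h by simp
  also have "\<dots> = W.hpart (\<one>\<^bsub>H\<^esub> \<otimes>\<^bsub>H\<^esub> h) (U i i 1 * U i j d) * U j j 1"
    using W.hpart_mult_right[OF unit_in_Delta_one[OF ij(2)] Uc(2) h] h by simp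
  also have "\<dots> = U i i 1 * W.hpart h (U i j d) * U j j 1"
    using W.hpart_mult_left[OF unit_in_Delta_one[OF ij(1)] Uc(1) h] by simp
  finally show ?thesis
    using unit_mat_corner[OF hc ij] by simp
qed

text \<open>Identifies \<open>D\<close> with the corner cut out by the idempotent at
  \<open>i\<close>, as an algebra, which is the structure for which \<Gamma> is assumed
  fine.\<close>

definition corner :: "nat \<Rightarrow> 'h \<Rightarrow> 'd set" where
  "corner i h = {d. U i i d \<in> \<Delta> h}"

lemma corner_grading:
  assumes i: "i < k"
  shows "group_grading H (type_algebra scale) (corner i)"
proof (rule group_gradingI[where P = "\<lambda>h d. W.hpart h (U i i d) $$ (i, i)"])
  let ?P = "\<lambda>h d. W.hpart h (U i i d) $$ (i, i)"
  have UP: "U i i (?P h d) = W.hpart h (U i i d)" if "h \<in> carrier H" for h d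
    using hpart_unit_mat[OF that i i] by simp
  have Uc: "U i i d \<in> carrier MA" for d :: 'd
    by simp
  show "comm_group H"
    by (rule W.G.comm_group_axioms)
  show "abelian_group (type_algebra scale)"
    by (rule D.A.is_abelian_group)
  show "submodule (corner i h) scalar_ring (type_algebra scale)" if h: "h \<in> carrier H" for h
  proof (rule D.L.submodule_by_closure)
    show "\<zero>\<^bsub>type_algebra scale\<^esub> \<in> corner i h"
      using W.component_zero[OF h] unit_mat_eq_zero_iff[OF i i, of "0 :: 'd"] by (simp add: corner_def)
    show "x \<oplus>\<^bsub>type_algebra scale\<^esub> y \<in> corner i h" if "x \<in> corner i h" "y \<in> corner i h" for x y
      using W.component_add[OF h] that by (simp add: corner_def unit_mat_add)
    fix c :: 'f and x assume "x \<in> corner i h"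
    moreover have "map_mat (scale c) (U i i x) = U i i (scale c x)"
      by (rule mat_eqI[of _ k]) auto
    ultimately show "c \<odot>\<^bsub>type_algebra scale\<^esub> x \<in> corner i h"
      using W.component_smult[OF h, of "U i i x" c] by (simp add: corner_def)
  qed simp
  show "x \<otimes>\<^bsub>type_algebra scale\<^esub> y \<in> corner i (g \<otimes>\<^bsub>H\<^esub> h)"
    if "g \<in> carrier H" "h \<in> carrier H" "x \<in> corner i g" "y \<in> corner i h" for g h x y
    using Delta_mult[OF that(1,2), of "U i i x" "U i i y"] that(3,4) i
    by (simp add: corner_def unit_mat_mult_unit_mat)
  show "?P h d \<in> corner i h" if "h \<in> carrier H" for h d
    using UP[OF that] W.hpart_in[OF Uc that] by (simp add: corner_def)
  show "?P h (a \<oplus>\<^bsub>type_algebra scale\<^esub> b) = ?P h a \<oplus>\<^bsub>type_algebra scale\<^esub> ?P h b"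
    if h: "h \<in> carrier H" for h a b
    using W.hpart_add[OF Uc Uc h, of a b] W.hpart_closed[OF Uc h, of b] i by (simp add: unit_mat_add)
  show "?P g x = (if g = h then x else \<zero>\<^bsub>type_algebra scale\<^esub>)"
    if "g \<in> carrier H" "h \<in> carrier H" "x \<in> corner i h" for g h x
    using W.hpart_homogeneous[of "U i i x" h g] that i by (simp add: corner_def)
  have supp: "{h \<in> carrier H. ?P h d \<noteq> \<zero>\<^bsub>type_algebra scale\<^esub>} = W.hsupp (U i i d)" for d
  proof -
    have "?P h d = 0 \<longleftrightarrow> W.hpart h (U i i d) = 0\<^sub>m k k" if "h \<in> carrier H" for h
      using unit_mat_eq_zero_iff[OF i i, of "?P h d"] unfolding UP[OF that] by blast
    then show ?thesis
      by (auto simp: W.hsupp_def)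
  qed
  show "finite {h \<in> carrier H. ?P h d \<noteq> \<zero>\<^bsub>type_algebra scale\<^esub>}" for d
    unfolding supp by (rule W.finite_hsupp[OF Uc])
  show "(\<Oplus>\<^bsub>type_algebra scale\<^esub>h\<in>{h \<in> carrier H. ?P h d \<noteq> \<zero>\<^bsub>type_algebra scale\<^esub>}. ?P h d) = d" for d
  proof -
    have "(\<Sum>h\<in>W.hsupp (U i i d). ?P h d) = finsum MA (\<lambda>h. W.hpart h (U i i d)) (W.hsupp (U i i d)) $$ (i, i)"
      using W.hpart_closed[OF Uc] i by (intro finsum_mat_algebra_index[symmetric]) (auto simp: W.hsupp_def)
    also have "\<dots> = d"
      using W.hpart_sum[OF Uc, of d] i by simp
    finally show ?thesis
      unfolding supp finsum_type_algebra .
  qed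
qed

lemma corner_refines:
  assumes "i < k"
  shows "refinement H (corner i) T \<Gamma>"
  unfolding refinement_def
proof
  fix h assume h: "h \<in> carrier H"
  obtain g where "g \<in> carrier GT" "\<Delta> h \<subseteq> MG g"
    using Delta_in_M_grading[OF h] .
  then have sub: "corner i h \<subseteq> entry_component i i g"
    using assms by (force simp: corner_def M_grading_eq)
  show "\<exists>t\<in>carrier T. corner i h \<subseteq> \<Gamma> t"
  proof (rule entry_component_cases[OF assms assms, of g])
    \<comment> \<open>No unit at \<open>(i, i)\<close> has degree \<open>g\<close>: the corner
      component is zero, and the trivial degree serves as a default.\<close>
    assume "entry_component i i g = {0}"
    then show ?thesis
      using sub D.component_zero[OF T.one_closed] by (intro bexI[of _ "\<one>\<^bsub>T\<^esub>"]) auto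
  qed (use sub in blast)
qed

end

section \<open>Fineness of the grading on \<open>D\<close> and the \<Delta>-degrees of matrix
  units\<close>

locale fine_refinement_data = refinement_data scale T q s ts \<Gamma> \<phi>\<^sub>0 \<delta> ds H \<Delta>
  for scale :: "'f::field \<Rightarrow> 'd::ring_1 \<Rightarrow> 'd"
    and T :: "'t monoid" and q s ts and \<Gamma> :: "'t \<Rightarrow> 'd set"
    and \<phi>\<^sub>0 :: "'d \<Rightarrow> 'd" and \<delta> :: 'f and ds :: "'d list"
    and H :: "'h monoid" and \<Delta> :: "'h \<Rightarrow> 'd mat set" +
  assumes fine_D: "fine_grading TYPE(nat) T (type_algebra scale) \<Gamma>"
    and finite_dim: "\<exists>B. finite_dimensional_vector_space scale B"
begin

text \<open>The identity lies in this corner component, so the component of \<Gamma> containing the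
  latter has trivial degree. A strict inclusion would make the corner grading a proper refinement of
  the fine grading \<Gamma>.\<close>

lemma corner_one:
  assumes "i < k"
  shows "corner i \<one>\<^bsub>H\<^esub> = \<Gamma> \<one>\<^bsub>T\<^esub>"
proof -
  interpret C: graded_algebra H "type_algebra scale" "corner i"
    using corner_grading[OF assms] by unfold_locales
  obtain B where "finite_dimensional_vector_space scale B"
    using finite_dim ..
  then have "finite (grading_support H (type_algebra scale) (corner i))"
    by (rule finite_grading_support[OF C.graded_algebra_axioms])
  then have not_proper: "\<not> proper_refinement H (corner i) T \<Gamma> (type_algebra scale)"
    by (intro C.fine_no_proper_refinement[OF fine_D] countable_finite)
  have one: "1 \<in> corner i \<one>\<^bsub>H\<^esub>"
    using unit_in_Delta_one[OF assms] by (simp add: corner_def)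
  obtain t where t: "t \<in> carrier T" "corner i \<one>\<^bsub>H\<^esub> \<subseteq> \<Gamma> t"
    using corner_refines[OF assms] W.G.one_closed unfolding refinement_def by blast
  then have "t = \<one>\<^bsub>T\<^esub>"
    using D.component_disjoint[of 1 t "\<one>\<^bsub>T\<^esub>"] one D.one_in_component by auto
  moreover have "corner i \<one>\<^bsub>H\<^esub> \<noteq> {0}"
    using one by auto
  ultimately show ?thesis
    using not_proper corner_refines[OF assms] t W.G.one_closed
    unfolding proper_refinement_def type_algebra_simps by blast
qed

lemma nonzero_in_component:
  assumes "t \<in> carrier T"
  obtains d where "d \<in> \<Gamma> t" "d \<noteq> 0"
  using full_support assms D.component_zero[OF assms] by (auto simp: grading_support_def)

text \<open>Projecting gives one nonzero homogeneous unit with entry \<open>d'\<close> in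
  \<open>\<Gamma> t\<close>. Any other \<open>e\<close> in \<open>\<Gamma> t\<close> is
  \<open>d'\<close> multiplied on the left by an element of trivial degree in \<open>D\<close>,
  which by \<open>corner_one\<close> does not change the \<Delta>-degree.\<close>

lemma unit_degree_homogeneous:
  assumes ij: "i < k" "j < k" and t: "t \<in> carrier T"
  obtains h where "h \<in> carrier H" "\<And>d. d \<in> \<Gamma> t \<Longrightarrow> U i j d \<in> \<Delta> h"
proof -
  obtain d where d: "d \<in> \<Gamma> t" "d \<noteq> 0"
    using nonzero_in_component[OF t] .
  have Uc: "U i j d \<in> carrier MA" "U i j d \<noteq> \<zero>\<^bsub>MA\<^esub>"
    using unit_mat_eq_zero_iff[OF ij] d(2) by auto
  obtain h where h: "h \<in> carrier H" "W.hpart h (U i j d) \<noteq> \<zero>\<^bsub>MA\<^esub>"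
    using W.hpart_nonzero[OF Uc] .
  define d' where "d' = W.hpart h (U i j d) $$ (i, j)"
  have U: "W.hpart h (U i j d) = U i j d'"
    unfolding d'_def by (rule hpart_unit_mat[OF h(1) ij])
  have Ud': "U i j d' \<in> \<Delta> h"
    using W.hpart_in[OF Uc(1) h(1)] U by simp
  have nz: "d' \<noteq> 0"
    using h(2) unit_mat_eq_zero_iff[OF ij, of d'] unfolding U by simp
  have "U i j d' \<in> MG (udeg i j t)"
    using hpart_in_M_grading[OF unit_mat_in_M_grading[OF ij t d(1)] unit_degree_closed[OF ij t] h(1)] U by simp
  then have "U i j d' $$ (i, j) \<in> entry_component i j (udeg i j t)"
    using ij unfolding M_grading_eq by blast
  then have "d' \<in> \<Gamma> t"
    using ij entry_component_unit_degree[OF ij t] by simp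
  then obtain y where y: "y * d' = 1" "y \<in> \<Gamma> (inv\<^bsub>T\<^esub> t)"
    using homogeneous_inverse[OF t _ nz] by blast
  show thesis
  proof (rule that[OF h(1)])
    fix e assume "e \<in> \<Gamma> t"
    then have "e * y \<in> \<Gamma> \<one>\<^bsub>T\<^esub>"
      using D.component_mult[of t "inv\<^bsub>T\<^esub> t" e y] y(2) t by simp
    then have "U i i (e * y) \<in> \<Delta> \<one>\<^bsub>H\<^esub>"
      using corner_one[OF ij(1)] by (auto simp: corner_def)
    then have "U i i (e * y) * U i j d' \<in> \<Delta> (\<one>\<^bsub>H\<^esub> \<otimes>\<^bsub>H\<^esub> h)"
      by (intro Delta_mult Ud' h W.G.one_closed)
    then show "U i j e \<in> \<Delta> h"
      using h(1) ij y(1) by (simp add: unit_mat_mult_unit_mat mult.assoc)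
  qed
qed

text \<open>The \<Delta>-degree of the units at \<open>(i, j)\<close> with entries in
  \<open>\<Gamma> t\<close>. For valid arguments it exists by the preceding lemma and is unique
  because \<open>\<Gamma> t\<close> is nonzero.\<close>

definition hdeg :: "nat \<Rightarrow> nat \<Rightarrow> 't \<Rightarrow> 'h" where
  "hdeg i j t = (SOME h. h \<in> carrier H \<and> (\<forall>d\<in>\<Gamma> t. U i j d \<in> \<Delta> h))"

lemma hdeg:
  assumes "i < k" "j < k" "t \<in> carrier T"
  shows hdeg_closed: "hdeg i j t \<in> carrier H"
    and unit_in_hdeg: "d \<in> \<Gamma> t \<Longrightarrow> U i j d \<in> \<Delta> (hdeg i j t)"
proof -
  have "\<exists>h. h \<in> carrier H \<and> (\<forall>d\<in>\<Gamma> t. U i j d \<in> \<Delta> h)"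
    using unit_degree_homogeneous[OF assms] by metis
  then have "hdeg i j t \<in> carrier H \<and> (\<forall>d\<in>\<Gamma> t. U i j d \<in> \<Delta> (hdeg i j t))"
    unfolding hdeg_def by (rule someI_ex)
  then show "hdeg i j t \<in> carrier H" "d \<in> \<Gamma> t \<Longrightarrow> U i j d \<in> \<Delta> (hdeg i j t)"
    by auto
qed

lemma hdeg_eqI:
  assumes "i < k" "j < k" "t \<in> carrier T" "d \<in> \<Gamma> t" "d \<noteq> 0" "h \<in> carrier H" "U i j d \<in> \<Delta> h"
  shows "hdeg i j t = h"
  using W.component_disjoint[OF unit_in_hdeg[OF assms(1-4)] assms(7) hdeg_closed[OF assms(1-3)] assms(6)]
    unit_mat_eq_zero_iff[OF assms(1,2), of d] assms(5) by simp

lemma hdeg_mult: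
  assumes "i < k" "j < k" "l < k" "t \<in> carrier T" "t' \<in> carrier T"
  shows "hdeg i l (t \<otimes>\<^bsub>T\<^esub> t') = hdeg i j t \<otimes>\<^bsub>H\<^esub> hdeg j l t'"
proof -
  obtain d d' where d: "d \<in> \<Gamma> t" "d \<noteq> 0" and d': "d' \<in> \<Gamma> t'" "d' \<noteq> 0"
    using nonzero_in_component assms(4,5) by metis
  have "U i j d * U j l d' \<in> \<Delta> (hdeg i j t \<otimes>\<^bsub>H\<^esub> hdeg j l t')"
    using assms d(1) d'(1) by (intro Delta_mult hdeg_closed unit_in_hdeg)
  then have "U i l (d * d') \<in> \<Delta> (hdeg i j t \<otimes>\<^bsub>H\<^esub> hdeg j l t')"
    using assms by (simp add: unit_mat_mult_unit_mat)
  moreover have "d * d' \<in> \<Gamma> (t \<otimes>\<^bsub>T\<^esub> t')" "d * d' \<noteq> 0"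
    using D.component_mult[OF assms(4,5) d(1) d'(1)] homogeneous_mult_eq_zero(1)[OF assms(4) d] d'(2) by auto
  ultimately show ?thesis
    using assms by (intro hdeg_eqI) (auto intro: hdeg_closed)
qed

text \<open>Multiplying by the degree of the unit at \<open>(i, j)\<close>, on the right for
  \<open>i\<close> and on the left for \<open>j\<close>, gives the same degree. Commutativity of
  \<open>H\<close> permits cancelling it.\<close>

lemma hdeg_diagonal:
  assumes "i < k" "j < k" "t \<in> carrier T"
  shows "hdeg i i t = hdeg j j t"
proof -
  have "hdeg i i t \<otimes>\<^bsub>H\<^esub> hdeg i j \<one>\<^bsub>T\<^esub> = hdeg i j \<one>\<^bsub>T\<^esub> \<otimes>\<^bsub>H\<^esub> hdeg j j t"
    using hdeg_mult[of i i j t "\<one>\<^bsub>T\<^esub>"] hdeg_mult[of i j j "\<one>\<^bsub>T\<^esub>" t] assms by simp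
  then have "hdeg i j \<one>\<^bsub>T\<^esub> \<otimes>\<^bsub>H\<^esub> hdeg i i t = hdeg i j \<one>\<^bsub>T\<^esub> \<otimes>\<^bsub>H\<^esub> hdeg j j t"
    using W.G.m_comm[OF hdeg_closed[OF assms(1,1,3)] hdeg_closed[OF assms(1,2) T.one_closed]] by simp
  then show ?thesis
    using assms hdeg_closed T.one_closed by simp
qed

text \<open>The involution turns a nonzero unit at \<open>(i, j)\<close> into a nonzero unit at the
  partner position. It preserves both gradings: the matrix grading places the new entry in
  \<open>\<Gamma> t'\<close>, and invariance of \<Delta> gives the equality of degrees.\<close>

lemma hdeg_partner:
  assumes ij: "i < k" "j < k" and t: "t \<in> carrier T" "t' \<in> carrier T"
    and eq: "udeg (partner q j) (partner q i) t' = udeg i j t"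
  shows "hdeg (partner q j) (partner q i) t' = hdeg i j t"
proof -
  let ?i = "partner q i" and ?j = "partner q j"
  note ij' = partner_less[OF ij(1)] partner_less[OF ij(2)]
  obtain d where d: "d \<in> \<Gamma> t" "d \<noteq> 0"
    using nonzero_in_component[OF t(1)] .
  let ?X = "MI (U i j d)"
  have Xc: "?X \<in> carrier_mat k k"
    by (rule MI_closed) simp
  have "?X \<in> MG (udeg i j t)"
    by (rule MI_in_M_grading[OF unit_mat_in_M_grading[OF ij t(1) d(1)]])
  then have "?X $$ (?j, ?i) \<in> entry_component ?j ?i (udeg i j t)"
    using ij' unfolding M_grading_eq by blast
  then have e: "?X $$ (?j, ?i) \<in> \<Gamma> t'"
    using entry_component_unit_degree[OF ij'(2,1) t(2)] eq by simp
  have X: "?X = U ?j ?i (?X $$ (?j, ?i))"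
  proof (rule mat_eqI[OF Xc unit_mat_closed])
    fix a b assume ab: "a < k" "b < k"
    have "?X $$ (a, b) = 0" if "\<not> (a = ?j \<and> b = ?i)"
    proof -
      have "U i j d $$ (partner q b, partner q a) = 0"
        using that unit_mat_index[OF partner_less[OF ab(2)] partner_less[OF ab(1)], of i j d] by auto
      then show ?thesis
        by (simp add: MI_index[OF unit_mat_closed ab])
    qed
    then show "?X $$ (a, b) = U ?j ?i (?X $$ (?j, ?i)) $$ (a, b)"
      unfolding unit_mat_index[OF ab] by (cases "a = ?j \<and> b = ?i") auto
  qed
  have "?X $$ (?j, ?i) \<noteq> 0"
  proof
    assume "?X $$ (?j, ?i) = 0"
    then have "?X = 0\<^sub>m k k"
      using X unit_mat_eq_zero_iff[OF ij'(2,1), of "?X $$ (?j, ?i)"] by simp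
    moreover have "MI (0\<^sub>m k k) = 0\<^sub>m k k"
      by (rule mat_eqI[OF MI_closed]) (auto simp: MI_index partner_less)
    ultimately have "U i j d = 0\<^sub>m k k"
      using MI_MI[of "U i j d"] by simp
    then show False
      using unit_mat_eq_zero_iff[OF ij, of d] d(2) by simp
  qed
  moreover have "U ?j ?i (?X $$ (?j, ?i)) \<in> \<Delta> (hdeg i j t)"
    using Delta_involution[OF hdeg_closed[OF ij t(1)] unit_in_hdeg[OF ij t(1) d(1)]] X by simp
  ultimately show ?thesis
    by (intro hdeg_eqI[OF ij'(2,1) t(2) e] hdeg_closed[OF ij t(1)])
qed

text \<open>The \<Delta>-degree depends only on the degree in the universal group, as each
  coincidence listed in \<open>unit_degree_cases\<close> also holds for \<Delta>.\<close>

lemma hdeg_cong: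
  assumes ij: "i < k" "j < k" "t \<in> carrier T" and ij': "i' < k" "j' < k" "t' \<in> carrier T"
    and eq: "udeg i j t = udeg i' j' t'"
  shows "hdeg i j t = hdeg i' j' t'"
proof (rule unit_degree_cases[OF ij ij' eq])
  assume same: "i = j" "i' = j'"
  \<comment> \<open>Both are the class of \<open>(0, t)\<close>, so the degrees in \<open>T\<close>
    can be compared at one diagonal position.\<close>
  have "udeg i' i' t = udeg i i t"
    by (simp add: unit_degree_def)
  then have "t = t'"
    using unit_degree_inj[OF ij'(1,1) ij(3) ij'(3)] eq same by simp
  then show ?thesis
    using hdeg_diagonal[OF ij(1) ij'(1) ij(3)] same by simp
next
  assume same: "i = i'" "j = j'"
  then show ?thesis
    using unit_degree_inj[OF ij(1,2,3) ij'(3)] eq by simp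
next
  assume "i' = partner q j" "j' = partner q i"
  then show ?thesis
    using hdeg_partner[OF ij ij'(3)] eq by simp
qed

text \<open>The inclusion opposite to refinement: all matrix units spanning \<open>MG g\<close>
  share one \<Delta>-degree by \<open>hdeg_cong\<close>, and so does every sum of them.\<close>

lemma M_grading_subset_Delta:
  assumes g: "g \<in> carrier GT" "MG g \<noteq> {0\<^sub>m k k}"
  obtains h where "h \<in> carrier H" "MG g \<subseteq> \<Delta> h"
proof -
  have "0\<^sub>m k k \<in> MG g"
    using Gr.component_zero[OF g(1)] by simp
  then obtain X where X: "X \<in> MG g" "X \<noteq> 0\<^sub>m k k"
    using g(2) by blast
  then have "X \<in> carrier_mat k k"
    by (simp add: M_grading_eq)
  then obtain i j where ij: "i < k" "j < k" "X $$ (i, j) \<noteq> 0"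
    using X(2) mat_eqI[of X k "0\<^sub>m k k"] by auto
  obtain t where t: "t \<in> carrier T" "udeg i j t = g"
    using M_grading_entry[OF X(1) ij] .
  let ?h = "hdeg i j t"
  have h: "?h \<in> carrier H"
    by (rule hdeg_closed[OF ij(1,2) t(1)])
  have "Y \<in> \<Delta> ?h" if Y: "Y \<in> MG g" for Y
  proof -
    have "unit_mat k (fst p) (snd p) (Y $$ p) \<in> \<Delta> ?h" if p: "p \<in> {..<k} \<times> {..<k}" for p
    proof -
      obtain a b where ab: "p = (a, b)" "a < k" "b < k"
        using p by auto
      show ?thesis
      proof (cases "Y $$ (a, b) = 0")
        case True
        then show ?thesis
          using ab W.component_zero[OF h] unit_mat_eq_zero_iff[OF ab(2,3), of "0 :: 'd"] by simp
      next
        case False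
        obtain t' where t': "t' \<in> carrier T" "udeg a b t' = g" "Y $$ (a, b) \<in> \<Gamma> t'"
          using M_grading_entry[OF Y ab(2,3) False] .
        then show ?thesis
          using unit_in_hdeg[OF ab(2,3) t'(1,3)] hdeg_cong[OF ij(1,2) t(1) ab(2,3) t'(1)] t(2) ab(1) by simp
      qed
    qed
    then have "(\<Oplus>\<^bsub>MA\<^esub>p\<in>{..<k} \<times> {..<k}. unit_mat k (fst p) (snd p) (Y $$ p)) \<in> \<Delta> ?h"
      by (rule W.component_finsum[OF h])
    moreover have "(\<Oplus>\<^bsub>MA\<^esub>p\<in>{..<k} \<times> {..<k}. unit_mat k (fst p) (snd p) (Y $$ p)) = Y"
      using Y by (intro mat_decompose[symmetric]) (simp add: M_grading_eq)
    ultimately show ?thesis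
      by (simp only:)
  qed
  then show thesis
    using that h by blast
qed

text \<open>A strict inclusion would put a nonzero component \<open>\<Delta> h\<close> strictly
  inside \<open>MG g\<close>, hence strictly inside some \<open>\<Delta> h'\<close>; disjointness of
  components then forces \<open>h = h'\<close>.\<close>

lemma not_proper: "\<not> proper_refinement H \<Delta> GT MG MA"
proof
  assume "proper_refinement H \<Delta> GT MG MA"
  then obtain h g where h: "h \<in> carrier H" "\<Delta> h \<noteq> {0\<^sub>m k k}" and g: "g \<in> carrier GT" "\<Delta> h \<subset> MG g"
    unfolding proper_refinement_def by auto
  obtain X where X: "X \<in> \<Delta> h" "X \<noteq> 0\<^sub>m k k"
    using h W.component_zero[OF h(1)] by auto
  then have "MG g \<noteq> {0\<^sub>m k k}"
    using g(2) by blast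
  then obtain h' where h': "h' \<in> carrier H" "MG g \<subseteq> \<Delta> h'"
    using M_grading_subset_Delta[OF g(1)] by blast
  then have "h = h'"
    using W.component_disjoint[of X h h'] X g(2) h(1) by auto
  then show False
    using g(2) h'(2) by blast
qed

end

theorem theorem4p7:
  fixes scale :: "'f::field \<Rightarrow> 'd::ring_1 \<Rightarrow> 'd"
    and T :: "'t monoid"
    and \<Gamma>\<^sub>D :: "'t \<Rightarrow> 'd set"
    and \<phi>\<^sub>0 :: "'d \<Rightarrow> 'd"
    and q s :: nat
    and \<delta> :: 'f
    and ds :: "'d list"
  assumes "assoc_algebra scale"
    and "\<exists>Basis. finite_dimensional_vector_space scale Basis"
    and "graded_division T (type_algebra scale) \<Gamma>\<^sub>D"
    and "grading_support T (type_algebra scale) \<Gamma>\<^sub>D = carrier T"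
    and "involution_grading T (type_algebra scale) \<phi>\<^sub>0 \<Gamma>\<^sub>D"
    and "(q, s) \<noteq> (0, 0)"
    and "\<delta> \<in> {1, -1}"
    and "length ds = q"
    and "\<forall>d\<in>set ds. d \<in> nonzero_homogeneous T (type_algebra scale) \<Gamma>\<^sub>D \<and> \<phi>\<^sub>0 d = scale \<delta> d"
    and "(q, s) \<noteq> (2, 0)"
    and "fine_grading TYPE(nat) T (type_algebra scale) \<Gamma>\<^sub>D"
  defines "ts \<equiv> map (degree_of T \<Gamma>\<^sub>D) ds"
  shows "fine_involution_grading TYPE('h)
           (G_tilde T q s ts)
           (mat_algebra scale (q + 2 * s))
           (M_involution scale \<phi>\<^sub>0 q s ds \<delta>)
           (M_grading scale T \<Gamma>\<^sub>D q s ts)"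
proof -
  interpret assoc_algebra scale
    by fact
  have gr: "group_grading T (type_algebra scale) \<Gamma>\<^sub>D"
    using assms(3) by (simp add: graded_division_def)
  interpret D: graded_algebra T "type_algebra scale" \<Gamma>\<^sub>D
    using gr by (intro graded_algebra.intro ring_type_algebra module_type_algebra graded_algebra_axioms.intro)
      (simp_all add: group_grading_def)
  have deg: "degree_of T \<Gamma>\<^sub>D d \<in> carrier T" "d \<in> \<Gamma>\<^sub>D (degree_of T \<Gamma>\<^sub>D d)" "d \<noteq> 0" if "d \<in> set ds" for d
  proof -
    obtain t where t: "t \<in> carrier T" "d \<in> \<Gamma>\<^sub>D t" "d \<noteq> 0"
      using assms(9) \<open>d \<in> set ds\<close> by (auto simp: nonzero_homogeneous_def)
    then have "degree_of T \<Gamma>\<^sub>D d = t"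
      unfolding degree_of_def using D.component_disjoint[of d] by (intro the_equality) auto
    then show "degree_of T \<Gamma>\<^sub>D d \<in> carrier T" "d \<in> \<Gamma>\<^sub>D (degree_of T \<Gamma>\<^sub>D d)" "d \<noteq> 0"
      using t by auto
  qed
  interpret involution_data scale T q s ts \<Gamma>\<^sub>D \<phi>\<^sub>0 \<delta> ds
  proof unfold_locales
    show "nonzero_homogeneous T (type_algebra scale) \<Gamma>\<^sub>D \<subseteq> Units (type_algebra scale)"
      using assms(3) by (simp add: graded_division_def)
  qed (use assms deg in \<open>auto simp: ts_def\<close>)
  \<comment> \<open>The competing group lives in the arbitrary type \<open>'h\<close>; the passage
    to \<open>nat\<close> happens only for the corners, inside \<open>corner_one\<close>.\<close>
  have "\<not> proper_refinement H \<Delta> GT MG MA" if \<Delta>: "involution_grading H MA MI \<Delta>"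
    for H :: "'h monoid" and \<Delta>
  proof
    assume proper: "proper_refinement H \<Delta> GT MG MA"
    have H: "group_grading H MA \<Delta>"
      using \<Delta> by (simp add: involution_grading_def)
    interpret W: graded_algebra H MA \<Delta>
      using H by (intro graded_algebra.intro ring_mat_algebra module_mat_algebra graded_algebra_axioms.intro)
        (simp_all add: group_grading_def)
    interpret fine_refinement_data scale T q s ts \<Gamma>\<^sub>D \<phi>\<^sub>0 \<delta> ds H \<Delta>
    proof unfold_locales
      show "MI X \<in> \<Delta> h" if "h \<in> carrier H" "X \<in> \<Delta> h" for h X
        using \<Delta> that unfolding involution_grading_def by blast
      show "refinement H \<Delta> GT MG"
        using proper by (simp add: proper_refinement_def)
    qed (use assms in auto)
    show False
      using not_proper proper by blast
  qed
  then show ?thesis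
    using M_involution_grading unfolding fine_involution_grading_def by blast
qed

end
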